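(* Let $G$ be a second countable locally compact abelian group, $(X,G,m)$ an ergodic measurable dynamical system with $m$ a probability measure and $L^2(X,m)$ separable, and let $\mathcal{A}=(A_n)$ be a tempered Følner sequence in $G$. Let $E\subseteq\mathcal{L}^2(X,m)$ be any subspace with a countable core. Then there exists a set $X_0\subseteq X$ of full measure such that: (1) the Fourier–Bohr coefficient $a_\chi^{\mathcal{A}}(f_x)$ exists for all $f\in E$, $x\in X_0$ and $\chi\in\widehat{G}$; (2) the Fourier–Bohr coefficient $a_\chi^{\mathcal{A}}(f_x)$ is zero for all $f\in E$, $x\in X_0$ and all $\chi\in\widehat{G}\setminus\mathbb{S}$.
   Context: $G$ is written additively, with a fixed Haar measure; $|A|$ is the Haar measure of $A\subseteq G$ and $dt$ denotes integration against it. $\widehat{G}$ is the dual group (continuous homomorphisms $G\to\{w\in\mathbb{C}:|w|=1\}$). A measurable dynamical system $(X,G,m)$ is a measurable space $(X,\Sigma)$ with a measurable action $G\times X\to X$, $(t,x)\mapsto t.x$, and a $G$-invariant measure $m$. It is ergodic if every measurable $f:X\to\mathbb{C}$ such that for each $t\in G$ one has $f(t.\,\cdot)=f$ a.e. is constant a.e. $\mathcal{L}^2(X,m)$ is the set of measurable functions $f:X\to\mathbb{C}$ (functions, not classes) with $\int_X|f|^2dm<\infty$; $L^2(X,m)$ is the Hilbert space of a.e.-classes. An eigenfunction to $\chi\in\widehat{G}$ is a nonzero $f\in L^2(X,m)$ with $f(t\,\cdot)=\chi(t)f$ for all $t\in G$; $\mathbb{S}\subseteq\widehat{G}$ is the set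 of $\chi$ possessing an eigenfunction (the eigenvalues). A Følner sequence is a sequence $(A_n)$ of open relatively compact subsets of $G$ (in particular $|A_n|>0$) with $\lim_n|A_n\triangle(t+A_n)|/|A_n|=0$ for all $t\in G$. It is tempered if there is $C>0$ with $\left|\bigcup_{k=1}^{n-1}(A_n-A_k)\right|\le C|A_n|$ for all $n$, where $A_n-A_k=\{a-b:a\in A_n,b\in A_k\}$. A subset $F\subseteq E$ is a core for $E$ if every element of $E$ is a uniform limit (w.r.t. $\sup_{x\in X}|\cdot|$) of a sequence in the linear span of $F$. For $f:X\to\mathbb{C}$ and $x\in X$ put $f_x(t)=f(t.x)$. The Fourier–Bohr coefficient is $a_\chi^{\mathcal{A}}(f_x)=\lim_n\frac{1}{|A_n|}\int_{A_n}f(t.x)\overline{\chi(t)}\,dt$, provided the limit exists. *)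

theory Defs
  imports "HOL-Probability.Probability" "HOL-Library.Function_Algebras"
begin

text \<open>
  A locally compact abelian group is a type of class \<open>topological_ab_group_add\<close>; the separation and
  countability axioms are the classes \<open>t2_space\<close> and \<open>second_countable_topology\<close>, and local
  compactness is an explicit assumption. Its Borel sigma-algebra is \<open>borel\<close>.
\<close>

definition haar_measure :: "'g::topological_ab_group_add measure \<Rightarrow> bool" where
  "haar_measure \<mu> \<longleftrightarrow>
     sets \<mu> = sets borel \<and>
     emeasure \<mu> UNIV \<noteq> 0 \<and>
     (\<forall>t. \<forall>B\<in>sets borel. emeasure \<mu> ((+) t ` B) = emeasure \<mu> B) \<and>
     (\<forall>K. compact K \<longrightarrow> emeasure \<mu> K < \<infinity>) \<and>
     (\<forall>B\<in>sets borel. emeasure \<mu> B = (INF U\<in>{U. open U \<and> B \<subseteq> U}. emeasure \<mu> U)) \<and>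
     (\<forall>U. open U \<longrightarrow> emeasure \<mu> U = (SUP K\<in>{K. compact K \<and> K \<subseteq> U}. emeasure \<mu> K))"

definition dual_group :: "('g::topological_ab_group_add \<Rightarrow> complex) set" where
  "dual_group = {\<xi>. continuous_on UNIV \<xi> \<and> (\<forall>t. norm (\<xi> t) = 1) \<and> (\<forall>s t. \<xi> (s + t) = \<xi> s * \<xi> t)}"

text \<open>
  The phase space is \<open>space m\<close>; values of the action and of functions outside of it are irrelevant.
\<close>

definition measurable_dynamical_system ::
    "('g::topological_ab_group_add \<Rightarrow> 'x \<Rightarrow> 'x) \<Rightarrow> 'x measure \<Rightarrow> bool" where
  "measurable_dynamical_system act m \<longleftrightarrow>
     (\<lambda>(t, x). act t x) \<in> measurable (borel \<Otimes>\<^sub>M m) m \<and>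
     (\<forall>x\<in>space m. act 0 x = x) \<and>
     (\<forall>s t. \<forall>x\<in>space m. act (s + t) x = act s (act t x)) \<and>
     (\<forall>t. distr m m (act t) = m)"

definition ergodic ::
    "('g::topological_ab_group_add \<Rightarrow> 'x \<Rightarrow> 'x) \<Rightarrow> 'x measure \<Rightarrow> bool" where
  "ergodic act m \<longleftrightarrow>
     (\<forall>f :: 'x \<Rightarrow> complex. f \<in> borel_measurable m \<longrightarrow>
        (\<forall>t. AE x in m. f (act t x) = f x) \<longrightarrow> (\<exists>c. AE x in m. f x = c))"

definition L2_funs :: "'x measure \<Rightarrow> ('x \<Rightarrow> complex) set" where
  "L2_funs m = {f. f \<in> borel_measurable m \<and> integrable m (\<lambda>x. (norm (f x))\<^sup>2)}"

definition L2_norm :: "'x measure \<Rightarrow> ('x \<Rightarrow> complex) \<Rightarrow> real" where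
  "L2_norm m f = sqrt (\<integral>x. (norm (f x))\<^sup>2 \<partial>m)"

text \<open>
  Elements of the Hilbert space of a.e.-classes are handled through representatives in \<open>L2_funs\<close>:
  equality of classes is equality a.e., and a set of representatives is dense in the quotient iff
  it is dense for the seminorm \<open>L2_norm\<close>.
\<close>

definition L2_separable :: "'x measure \<Rightarrow> bool" where
  "L2_separable m \<longleftrightarrow>
     (\<exists>D. countable D \<and> D \<subseteq> L2_funs m \<and>
        (\<forall>f\<in>L2_funs m. \<forall>\<epsilon>>0. \<exists>g\<in>D. L2_norm m (\<lambda>x. f x - g x) < \<epsilon>))"

definition eigenfunction ::
    "('g::topological_ab_group_add \<Rightarrow> 'x \<Rightarrow> 'x) \<Rightarrow> 'x measure \<Rightarrow> ('g \<Rightarrow> complex) \<Rightarrow> ('x \<Rightarrow> complex) \<Rightarrow> bool"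
  where
  "eigenfunction act m \<xi> f \<longleftrightarrow>
     f \<in> L2_funs m \<and> \<not> (AE x in m. f x = 0) \<and> (\<forall>t. AE x in m. f (act t x) = \<xi> t * f x)"

definition eigenvalues ::
    "('g::topological_ab_group_add \<Rightarrow> 'x \<Rightarrow> 'x) \<Rightarrow> 'x measure \<Rightarrow> ('g \<Rightarrow> complex) set" where
  "eigenvalues act m = {\<xi> \<in> dual_group. \<exists>f. eigenfunction act m \<xi> f}"

definition folner_sequence ::
    "'g::topological_ab_group_add measure \<Rightarrow> (nat \<Rightarrow> 'g set) \<Rightarrow> bool" where
  "folner_sequence \<mu> A \<longleftrightarrow>
     (\<forall>n. open (A n) \<and> compact (closure (A n)) \<and> measure \<mu> (A n) > 0) \<and>
     (\<forall>t. (\<lambda>n. measure \<mu> (sym_diff (A n) ((+) t ` A n)) / measure \<mu> (A n)) \<longlonglongrightarrow> 0)"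

text \<open>Sequences start at index 0, so the union runs over all earlier members of the sequence.\<close>

definition tempered ::
    "'g::topological_ab_group_add measure \<Rightarrow> (nat \<Rightarrow> 'g set) \<Rightarrow> bool" where
  "tempered \<mu> A \<longleftrightarrow>
     (\<exists>C::real. C > 0 \<and>
        (\<forall>n. emeasure \<mu> (\<Union>k<n. {a - b |a b. a \<in> A n \<and> b \<in> A k}) \<le> ennreal C * emeasure \<mu> (A n)))"

text \<open>Complex-valued functions form a complex vector space under the pointwise operations.\<close>

global_interpretation cfun: vector_space "\<lambda>(c::complex) (f::'x \<Rightarrow> complex) x. c * f x"
  by unfold_locales (auto simp: fun_eq_iff algebra_simps)

text \<open>\<open>F\<close> is a core for \<open>E\<close>, where \<open>X\<close> is the set on which the uniform distance is taken.\<close>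

definition core_for :: "'x set \<Rightarrow> ('x \<Rightarrow> complex) set \<Rightarrow> ('x \<Rightarrow> complex) set \<Rightarrow> bool" where
  "core_for X F E \<longleftrightarrow>
     F \<subseteq> E \<and>
     (\<forall>f\<in>E. \<exists>s :: nat \<Rightarrow> 'x \<Rightarrow> complex. (\<forall>n. s n \<in> cfun.span F) \<and> uniform_limit X s f sequentially)"

text \<open>
  \<open>has_fourier_bohr_coeff \<mu> A h \<xi> a\<close>: the Fourier-Bohr coefficient of \<open>h\<close> at \<open>\<xi>\<close> exists and equals
  \<open>a\<close>. Integrability is required explicitly because the library integral is 0 for non-integrable
  functions.
\<close>

definition has_fourier_bohr_coeff ::
    "'g::topological_ab_group_add measure \<Rightarrow> (nat \<Rightarrow> 'g set) \<Rightarrow> ('g \<Rightarrow> complex) \<Rightarrow> ('g \<Rightarrow> complex)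
      \<Rightarrow> complex \<Rightarrow> bool" where
  "has_fourier_bohr_coeff \<mu> A h \<xi> a \<longleftrightarrow>
     (\<forall>n. set_integrable \<mu> (A n) (\<lambda>t. h t * cnj (\<xi> t))) \<and>
     (\<lambda>n. (LINT t:A n|\<mu>. h t * cnj (\<xi> t)) / complex_of_real (measure \<mu> (A n))) \<longlonglongrightarrow> a"

end

theory Submission
  imports Defs
begin

text \<open>
  Write \<open>A\<^sub>n f (x)\<close> for the average of \<open>f (t.x) cnj (\<xi> t)\<close> over \<open>t \<in> A n\<close>; the claim is that these
  averages converge for all \<open>\<xi>\<close> simultaneously, off one null set of \<open>x\<close>. For a fixed \<open>x\<close>, the
  functions \<open>f\<close> for which this holds form a subspace closed under uniform limits
  (\<open>bohr_regular_subspace\<close>, \<open>bohr_regular_uniform_limit\<close>), so a countable core reduces the theorem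
  to a single \<open>f\<close> in \<open>L\<^sup>1\<close> (\<open>AE_bohr_regular\<close>). Three ideas carry that case.

  \<^emph>\<open>Maximal inequality.\<close> For tempered Folner sequences the supremum over \<open>n\<close> of the averages of
  \<open>|f|\<close> is of weak type (1,1) (\<open>weak_maximal_inequality\<close>; this is Lindenstrauss' inequality). It is
  transferred from a covering statement on the group, \<open>weighted_covering\<close>. Working from the largest
  index down, a translate \<open>A n + a\<close> is discarded when too much weight has already been given to
  larger translates meeting it. Temperedness bounds the total measure discarded because of one kept
  translate \<open>A k + b\<close>: all such \<open>a\<close> lie in \<open>b\<close> plus the union of the \<open>A k - A n\<close> with \<open>n < k\<close>.
  Translates of the same size overlap without control, so each kept translate \<open>A n + a\<close> is counted
  with density \<open>1 / |A n|\<close> in \<open>a\<close>; this takes the place of the random thinning in the usual proof.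

  \<^emph>\<open>A fixed character.\<close> Let \<open>f\<close> be bounded. By the Folner property \<open>A\<^sub>n (A\<^sub>k f) - A\<^sub>n f\<close> tends to 0
  uniformly on the phase space. Hence \<open>A\<^sub>n f\<close> is eventually almost as short in \<open>L\<^sup>2\<close> as any function
  with the same asymptotic averages, and the parallelogram law makes it Cauchy
  (\<open>bohr_avg_L2_Cauchy\<close>). Its limit \<open>g\<close> satisfies \<open>g (t.x) = \<xi> t g x\<close> (\<open>mean_ergodic\<close>), and the maximal
  inequality applied to \<open>A\<^sub>k f - g\<close> turns mean convergence into convergence almost everywhere
  (\<open>pointwise_ergodic\<close>). Eigenfunctions to distinct characters are orthogonal, so there are only
  countably many eigenvalues (\<open>countable_eigenvalues\<close>), and this settles all of them at once.

  \<^emph>\<open>All other characters.\<close> There may be uncountably many, so the exceptional null set must not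
  depend on \<open>\<xi>\<close>. By Cauchy-Schwarz \<open>|A\<^sub>n f (x)|\<^sup>2\<close> is, up to an error tending to 0, at most the untwisted
  average along the orbit of \<open>x\<close> of \<open>|A\<^sub>k f|\<^sup>2\<close>. Expanding this square gives an integral over \<open>s\<close> and \<open>t\<close>
  in \<open>A k\<close> of orbit averages of the correlations \<open>f (s.y) cnj (f (t.y))\<close>, in which \<open>\<xi>\<close> enters only as a
  weight of modulus one. By ergodicity and Fubini almost every \<open>x\<close> has the right correlations for
  almost all \<open>(s, t)\<close>, and for such \<open>x\<close> and every \<open>\<xi>\<close> the limit superior of \<open>|A\<^sub>n f (x)|\<^sup>2\<close> is at most
  \<open>\<integral> |A\<^sub>k f|\<^sup>2\<close>, for each \<open>k\<close>. This bound tends to 0 as \<open>k\<close> grows, because a nonzero mean ergodic limit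
  would be an eigenfunction to \<open>\<xi>\<close> (\<open>wiener_wintner_bounded\<close>).

  Truncation passes from bounded to integrable functions: the maximal inequality makes all averages
  of the truncation error small at once, uniformly in \<open>n\<close> and \<open>\<xi>\<close>.
\<close>

section \<open>Haar measure and the covering argument\<close>

lemma open_diff_set:
  fixes S T :: "'g::topological_ab_group_add set"
  assumes "open S"
  shows "open {a - b |a b. a \<in> S \<and> b \<in> T}"
proof -
  have "{a - b |a b. a \<in> S \<and> b \<in> T} = (\<Union>b\<in>T. (\<lambda>x. x + b) -` S)"
    by (auto simp: vimage_def) (metis add_diff_cancel_right')
  moreover have "open ((\<lambda>x. x + b) -` S)" for b
    by (intro open_vimage assms continuous_intros)
  ultimately show ?thesis by auto
qed

lemma group_uminus_measurable [measurable (raw)]: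
  fixes f :: "'a \<Rightarrow> 'g::{topological_ab_group_add, second_countable_topology}"
  assumes f: "f \<in> borel_measurable M"
  shows "(\<lambda>x. - f x) \<in> borel_measurable M"
  by (rule borel_measurable_continuous_on[OF _ f]) (intro continuous_intros)

lemma group_diff_measurable [measurable (raw)]:
  fixes f g :: "'a \<Rightarrow> 'g::{topological_ab_group_add, second_countable_topology}"
  assumes f: "f \<in> borel_measurable M" and g: "g \<in> borel_measurable M"
  shows "(\<lambda>x. f x - g x) \<in> borel_measurable M"
  using borel_measurable_add[OF f group_uminus_measurable[OF g]] by simp

locale tempered_folner =
  fixes \<mu> :: "'g::{topological_ab_group_add, t2_space, second_countable_topology} measure"
    and A :: "nat \<Rightarrow> 'g set" and C :: real
  assumes haar: "haar_measure \<mu>"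
    and folner: "folner_sequence \<mu> A"
    and C_pos: "C > 0"
    and temperedness: "\<And>n. emeasure \<mu> (\<Union>k<n. {a - b |a b. a \<in> A n \<and> b \<in> A k}) \<le> ennreal C * emeasure \<mu> (A n)"
begin

lemma sets_haar [measurable_cong, simp]: "sets \<mu> = sets borel"
  using haar by (simp add: haar_measure_def)

lemma space_haar [simp]: "space \<mu> = UNIV"
  using sets_eq_imp_space_eq[OF sets_haar] by simp

lemma open_A: "open (A n)" and measure_A_pos: "measure \<mu> (A n) > 0"
  using folner by (auto simp: folner_sequence_def)

lemma sets_A [measurable]: "A n \<in> sets borel"
  using open_A by auto

lemma emeasure_A: "emeasure \<mu> (A n) = ennreal (measure \<mu> (A n))"
  using measure_A_pos[of n] by (metis emeasure_eq_ennreal_measure measure_zero_top less_irrefl)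

lemma emeasure_translate: "B \<in> sets borel \<Longrightarrow> emeasure \<mu> ((+) t ` B) = emeasure \<mu> B"
  using haar by (auto simp: haar_measure_def)

lemma distr_translate: "distr \<mu> \<mu> ((+) t) = \<mu>"
proof (rule measure_eqI)
  fix B assume "B \<in> sets (distr \<mu> \<mu> ((+) t))"
  then have B [measurable]: "B \<in> sets borel" by simp
  have "(+) t -` B = (+) (- t) ` B"
    by (auto simp: image_iff algebra_simps intro!: bexI)
  then show "emeasure (distr \<mu> \<mu> ((+) t)) B = emeasure \<mu> B"
    using emeasure_translate[OF B, of "- t"] by (subst emeasure_distr) (simp_all del: add_uminus_conv_diff)
qed simp

lemma nn_integral_translate:
  assumes [measurable]: "f \<in> borel_measurable borel"
  shows "(\<integral>\<^sup>+s. f (t + s) \<partial>\<mu>) = (\<integral>\<^sup>+s. f s \<partial>\<mu>)"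
  by (subst (2) distr_translate[of t, symmetric]) (simp add: nn_integral_distr)

lemma integral_translate:
  fixes f :: "'g \<Rightarrow> 'b::{banach, second_countable_topology}"
  assumes [measurable]: "f \<in> borel_measurable borel"
  shows "(\<integral>s. f (t + s) \<partial>\<mu>) = (\<integral>s. f s \<partial>\<mu>)"
  by (subst (2) distr_translate[of t, symmetric]) (simp add: integral_distr)

text \<open>
  The translates of the open set \<open>A 0\<close> cover the group and have finite measure; by the Lindelof
  property countably many of them suffice.
\<close>

sublocale sigma_finite_measure \<mu>
proof
  obtain a where a: "a \<in> A 0"
    using measure_A_pos[of 0] by force
  let ?F = "range (\<lambda>t. (+) t ` A 0)"
  have op: "open S" if "S \<in> ?F" for S
  proof -
    obtain t where "S = (+) t ` A 0" using \<open>S \<in> ?F\<close> by blast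
    moreover have "(+) t ` A 0 = (\<lambda>x. - t + x) -` A 0"
      by (auto simp: image_iff intro!: bexI[of _ "- t + _"])
    ultimately show ?thesis
      using open_vimage[OF open_A, of "\<lambda>x. - t + x"] by (simp add: continuous_intros)
  qed
  obtain F' where F': "F' \<subseteq> ?F" "countable F'" "\<Union>F' = \<Union>?F"
    using Lindelof[of ?F] op by blast
  have "x \<in> \<Union>?F" for x
    using a by (auto simp: image_iff intro!: exI[of _ "x - a"] bexI[of _ a])
  then have "\<Union>F' = space \<mu>" using F' by auto
  moreover have "F' \<subseteq> sets \<mu>" using F' op by auto
  moreover have "emeasure \<mu> S \<noteq> \<infinity>" if "S \<in> F'" for S
  proof -
    obtain t where "S = (+) t ` A 0" using F'(1) \<open>S \<in> F'\<close> by blast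
    then show ?thesis by (simp add: emeasure_translate emeasure_A)
  qed
  ultimately show "\<exists>F. countable F \<and> F \<subseteq> sets \<mu> \<and> \<Union>F = space \<mu> \<and> (\<forall>a\<in>F. emeasure \<mu> a \<noteq> \<infinity>)"
    using F'(2) by (intro exI[of _ F'] conjI ballI) simp_all
qed

sublocale pair: pair_sigma_finite \<mu> \<mu> ..

text \<open>
  Abelian groups are unimodular. Integrating \<open>1 (t) f (s - t)\<close>, with \<open>1\<close> the indicator of \<open>A 0\<close>, first
  over \<open>s\<close> gives \<open>|A 0|\<close> times the integral of \<open>f\<close>; substituting \<open>t + s\<close> for \<open>t\<close> and then integrating
  first over \<open>s\<close> gives \<open>|A 0|\<close> times the integral of the reflection of \<open>f\<close>.
\<close>

lemma nn_integral_reflect: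
  assumes [measurable]: "f \<in> borel_measurable borel"
  shows "(\<integral>\<^sup>+s. f (- s) \<partial>\<mu>) = (\<integral>\<^sup>+s. f s \<partial>\<mu>)"
proof -
  let ?a = "emeasure \<mu> (A 0)"
  have a: "?a \<noteq> 0" "?a \<noteq> \<top>"
    using emeasure_A[of 0] measure_A_pos[of 0] by auto
  have "(\<integral>\<^sup>+s. f s \<partial>\<mu>) * ?a = (\<integral>\<^sup>+t. indicator (A 0) t * (\<integral>\<^sup>+s. f (-t + s) \<partial>\<mu>) \<partial>\<mu>)"
    by (subst nn_integral_translate) (simp_all add: nn_integral_multc mult.commute[of "integral\<^sup>N \<mu> f"])
  also have "\<dots> = (\<integral>\<^sup>+t. \<integral>\<^sup>+s. indicator (A 0) t * f (-t + s) \<partial>\<mu> \<partial>\<mu>)"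
    by (simp add: nn_integral_cmult)
  also have "\<dots> = (\<integral>\<^sup>+s. \<integral>\<^sup>+t. indicator (A 0) t * f (-t + s) \<partial>\<mu> \<partial>\<mu>)"
    by (rule pair.Fubini') simp
  also have "\<dots> = (\<integral>\<^sup>+s. \<integral>\<^sup>+t. indicator (A 0) (s + t) * f (- t) \<partial>\<mu> \<partial>\<mu>)"
  proof (rule nn_integral_cong)
    fix s
    show "(\<integral>\<^sup>+t. indicator (A 0) t * f (-t + s) \<partial>\<mu>) = (\<integral>\<^sup>+t. indicator (A 0) (s + t) * f (- t) \<partial>\<mu>)"
      by (subst nn_integral_translate[of "\<lambda>t. indicator (A 0) t * f (-t + s)" s, symmetric]) simp_all
  qed
  also have "\<dots> = (\<integral>\<^sup>+t. \<integral>\<^sup>+s. indicator (A 0) (t + s) * f (- t) \<partial>\<mu> \<partial>\<mu>)"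
    by (subst pair.Fubini') (simp_all add: add.commute)
  also have "\<dots> = (\<integral>\<^sup>+t. f (- t) \<partial>\<mu>) * ?a"
  proof -
    have "(\<integral>\<^sup>+s. indicator (A 0) (t + s) * f (- t) \<partial>\<mu>) = f (- t) * ?a" for t
      by (simp add: nn_integral_multc nn_integral_cmult nn_integral_translate mult.commute)
    then show ?thesis by (simp add: nn_integral_multc)
  qed
  finally show ?thesis using a by (metis ennreal_mult_divide_eq)
qed

text \<open>
  A translate \<open>A k + b\<close> with \<open>k < n\<close> meets \<open>A n + a\<close> exactly when \<open>b - a\<close> lies in \<open>A n - A k\<close>, hence
  only if it lies in \<open>earlier_diffs n\<close>.
\<close>

definition earlier_diffs :: "nat \<Rightarrow> 'g set" where
  "earlier_diffs n = (\<Union>k<n. {a - b |a b. a \<in> A n \<and> b \<in> A k})"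

lemma sets_earlier_diffs [measurable]: "earlier_diffs n \<in> sets borel"
  unfolding earlier_diffs_def by (intro borel_open open_UN ballI open_diff_set open_A)

lemma emeasure_earlier_diffs: "emeasure \<mu> (earlier_diffs n) \<le> ennreal C * emeasure \<mu> (A n)"
  using temperedness by (simp add: earlier_diffs_def)

text \<open>
  If \<open>W k\<close> is the set of kept base points at level \<open>k\<close>, each of density \<open>1 / |A k|\<close>, then
  \<open>crowding N W n a\<close> bounds the total weight of the kept translates of levels between \<open>n\<close> and \<open>N\<close>
  which meet \<open>A n + a\<close>.
\<close>

definition crowding :: "nat \<Rightarrow> (nat \<Rightarrow> 'g set) \<Rightarrow> nat \<Rightarrow> 'g \<Rightarrow> ennreal" where
  "crowding N W n a = (\<Sum>k\<in>{n<..<N}. (\<integral>\<^sup>+b. indicator (W k) b * indicator (earlier_diffs k) (a - b) \<partial>\<mu>) / emeasure \<mu> (A k))"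

lemma measurable_crowding [measurable]:
  assumes [measurable]: "\<And>k. W k \<in> sets borel"
  shows "crowding N W n \<in> borel_measurable borel"
  unfolding crowding_def by measurable

lemma crowding_cong: "(\<And>k. n < k \<Longrightarrow> W k = W' k) \<Longrightarrow> crowding N W n a = crowding N W' n a"
  by (auto simp: crowding_def intro!: sum.cong)

text \<open>
  The equation for \<open>W n\<close> refers only to levels above \<open>n\<close>, so it can be solved downwards from \<open>N\<close>.
\<close>

lemma selection_exists:
  assumes [measurable]: "\<And>n. B n \<in> sets borel"
  obtains W where "\<And>n. W n \<in> sets borel" "\<And>n. n < N \<Longrightarrow> W n = {a \<in> B n. crowding N W n a \<le> 1}"
proof -
  have "\<exists>W. (\<forall>n. W n \<in> sets borel) \<and> (\<forall>n<N. N \<le> n + j \<longrightarrow> W n = {a \<in> B n. crowding N W n a \<le> 1})" for j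
  proof (induction j)
    case 0
    show ?case by (intro exI[of _ "\<lambda>_. {}"]) auto
  next
    case (Suc j)
    then obtain W where W [measurable]: "\<And>n. W n \<in> sets borel"
      and W2: "\<And>n. n < N \<Longrightarrow> N \<le> n + j \<Longrightarrow> W n = {a \<in> B n. crowding N W n a \<le> 1}"
      by blast
    define p where "p = N - Suc j"
    define W' where "W' = W(p := {a \<in> B p. crowding N W p a \<le> 1})"
    have *: "crowding N W' n a = crowding N W n a" if "n \<ge> p" for n a
      using that by (intro crowding_cong) (auto simp: W'_def)
    have "W' n \<in> sets borel" for n
      by (auto simp: W'_def)
    moreover have "W' n = {a \<in> B n. crowding N W' n a \<le> 1}" if "n < N" "N \<le> n + Suc j" for n
    proof -
      have "p \<le> n" using that by (auto simp: p_def)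
      then show ?thesis using * W2[OF that(1)] that
        by (cases "n = p") (auto simp: W'_def p_def)
    qed
    ultimately show ?case by blast
  qed
  from this[of N] that show ?thesis by auto
qed

text \<open>
  The sets \<open>B n\<close> consist of base points \<open>a\<close> at which the average of \<open>\<Phi>\<close> over \<open>A n + a\<close> is at least \<open>l\<close>.
  The selection \<open>W\<close> keeps a fixed proportion of their total measure, since the rejected points are
  paid for by the crowding, whose integral temperedness bounds by \<open>C\<close> times the measure of \<open>W\<close>. At
  the same time the kept translates, weighted by \<open>1 / |A n|\<close>, cover no point with total weight above 2,
  so summing the averages of \<open>\<Phi>\<close> over them gives at most twice the integral of \<open>\<Phi>\<close>.
\<close>

theorem weighted_covering:
  assumes B [measurable]: "\<And>n. B n \<in> sets borel" and disj: "disjoint_family B"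
    and \<Phi> [measurable]: "\<Phi> \<in> borel_measurable borel"
    and large: "\<And>n a. n < N \<Longrightarrow> a \<in> B n \<Longrightarrow>
       l * emeasure \<mu> (A n) \<le> (\<integral>\<^sup>+t. indicator (A n) t * \<Phi> (t + a) \<partial>\<mu>)"
  shows "l * (\<Sum>n<N. emeasure \<mu> (B n)) \<le> ennreal (2 * (1 + C)) * (\<integral>\<^sup>+t. \<Phi> t \<partial>\<mu>)"
proof -
  obtain W where W [measurable]: "\<And>n. W n \<in> sets borel"
    and W_eq: "\<And>n. n < N \<Longrightarrow> W n = {a \<in> B n. crowding N W n a \<le> 1}"
    using selection_exists[of B N] B by blast
  define \<alpha> where "\<alpha> n = emeasure \<mu> (A n)" for n
  have \<alpha>: "\<alpha> n \<noteq> 0" "\<alpha> n \<noteq> \<top>" for n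
    using emeasure_A[of n] measure_A_pos[of n] by (auto simp: \<alpha>_def)
  define R where "R n = {a \<in> B n. \<not> crowding N W n a \<le> 1}" for n
  have R [measurable]: "R n \<in> sets borel" for n
    unfolding R_def by measurable
  define S where "S a = (\<Sum>k<N. (\<integral>\<^sup>+b. indicator (W k) b * indicator (earlier_diffs k) (a - b) \<partial>\<mu>) / \<alpha> k)" for a
  have S [measurable]: "S \<in> borel_measurable borel"
    unfolding S_def by measurable
  have crowding_le: "crowding N W n a \<le> S a" for n a
    unfolding crowding_def S_def \<alpha>_def by (intro sum_mono2) auto
  have disjR: "disjoint_family_on R {..<N}"
    using disj by (auto simp: disjoint_family_on_def R_def)
  \<comment> \<open>Chebyshev: the rejected points carry crowding greater than 1.\<close>
  have "(\<Sum>n<N. emeasure \<mu> (R n)) = emeasure \<mu> (\<Union>n<N. R n)"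
    using disjR by (subst sum_emeasure) auto
  also have "\<dots> = (\<integral>\<^sup>+a. indicator (\<Union>n<N. R n) a \<partial>\<mu>)"
    by (subst nn_integral_indicator) auto
  also have "\<dots> \<le> (\<integral>\<^sup>+a. S a \<partial>\<mu>)"
  proof (rule nn_integral_mono)
    fix a
    have "1 \<le> S a" if "a \<in> R n" for n
      using that crowding_le[of n a] by (auto simp: R_def)
    then show "indicator (\<Union>n<N. R n) a \<le> S a"
      by (auto split: split_indicator)
  qed
  also have "\<dots> = (\<Sum>k<N. (\<integral>\<^sup>+a. (\<integral>\<^sup>+b. indicator (W k) b * indicator (earlier_diffs k) (a - b) \<partial>\<mu>) \<partial>\<mu>) / \<alpha> k)"
    unfolding S_def by (simp add: nn_integral_sum nn_integral_divide)
  also have "\<dots> \<le> (\<Sum>k<N. ennreal C * emeasure \<mu> (W k))"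
  proof (rule sum_mono)
    fix k
    have "(\<integral>\<^sup>+a. (\<integral>\<^sup>+b. indicator (W k) b * indicator (earlier_diffs k) (a - b) \<partial>\<mu>) \<partial>\<mu>)
        = (\<integral>\<^sup>+b. (\<integral>\<^sup>+a. indicator (W k) b * indicator (earlier_diffs k) (a - b) \<partial>\<mu>) \<partial>\<mu>)"
      by (rule pair.Fubini') measurable
    also have "\<dots> = (\<integral>\<^sup>+b. indicator (W k) b * (\<integral>\<^sup>+a. indicator (earlier_diffs k) (- b + a) \<partial>\<mu>) \<partial>\<mu>)"
      by (simp add: nn_integral_cmult)
    also have "\<dots> = emeasure \<mu> (W k) * emeasure \<mu> (earlier_diffs k)"
      by (subst nn_integral_translate) (simp_all add: nn_integral_multc)
    also have "\<dots> \<le> emeasure \<mu> (W k) * (ennreal C * \<alpha> k)"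
      unfolding \<alpha>_def by (intro mult_left_mono emeasure_earlier_diffs) auto
    finally have "(\<integral>\<^sup>+a. (\<integral>\<^sup>+b. indicator (W k) b * indicator (earlier_diffs k) (a - b) \<partial>\<mu>) \<partial>\<mu>) / \<alpha> k
       \<le> emeasure \<mu> (W k) * (ennreal C * \<alpha> k) / \<alpha> k"
      by (rule divide_right_mono_ennreal)
    also have "emeasure \<mu> (W k) * (ennreal C * \<alpha> k) / \<alpha> k = ennreal C * emeasure \<mu> (W k)"
    proof -
      have "emeasure \<mu> (W k) * (ennreal C * \<alpha> k) = ennreal C * emeasure \<mu> (W k) * \<alpha> k"
        by (simp only: mult_ac)
      then show ?thesis
        using ennreal_mult_divide_eq[OF \<alpha>[of k]] by simp
    qed
    finally show "(\<integral>\<^sup>+a. (\<integral>\<^sup>+b. indicator (W k) b * indicator (earlier_diffs k) (a - b) \<partial>\<mu>) \<partial>\<mu>) / \<alpha> k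
       \<le> ennreal C * emeasure \<mu> (W k)" .
  qed
  finally have rejected: "(\<Sum>n<N. emeasure \<mu> (R n)) \<le> ennreal C * (\<Sum>k<N. emeasure \<mu> (W k))"
    by (simp add: sum_distrib_left)
  have "emeasure \<mu> (B n) = emeasure \<mu> (W n) + emeasure \<mu> (R n)" if "n < N" for n
  proof -
    have "B n = W n \<union> R n" "W n \<inter> R n = {}" using W_eq[OF that] by (auto simp: R_def)
    then show ?thesis by (simp add: plus_emeasure)
  qed
  then have "(\<Sum>n<N. emeasure \<mu> (B n)) = (\<Sum>n<N. emeasure \<mu> (W n)) + (\<Sum>n<N. emeasure \<mu> (R n))"
    by (simp add: sum.distrib)
  also have "\<dots> \<le> (\<Sum>n<N. emeasure \<mu> (W n)) + ennreal C * (\<Sum>k<N. emeasure \<mu> (W k))"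
    using rejected by (intro add_left_mono)
  also have "\<dots> = ennreal (1 + C) * (\<Sum>k<N. emeasure \<mu> (W k))"
    using C_pos by (simp add: ennreal_plus distrib_right)
  finally have BW: "(\<Sum>n<N. emeasure \<mu> (B n)) \<le> ennreal (1 + C) * (\<Sum>k<N. emeasure \<mu> (W k))" .
  \<comment> \<open>The total weight with which the kept translates cover \<open>t\<close>.\<close>
  define M where "M t = (\<Sum>k<N. (\<integral>\<^sup>+a. indicator (W k) a * indicator (A k) (t - a) \<partial>\<mu>) / \<alpha> k)" for t
  have M2: "M t \<le> 2" for t
  proof -
    define T where "T k = (\<integral>\<^sup>+a. indicator (W k) a * indicator (A k) (t - a) \<partial>\<mu>) / \<alpha> k" for k
    show ?thesis
    proof (cases "\<exists>k<N. T k \<noteq> 0")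
      case False
      then have "M t = 0" by (auto simp: M_def T_def)
      then show ?thesis by simp
    next
      case True
      \<comment> \<open>At the lowest level \<open>n\<close> that reaches \<open>t\<close> the weight is at most 1 because of the density
        \<open>1 / |A n|\<close>; all higher levels together contribute at most the crowding at a kept point \<open>a\<close> with
        \<open>t \<in> A n + a\<close>, which is at most 1 as well.\<close>
      define n where "n = (LEAST k. k < N \<and> T k \<noteq> 0)"
      have n: "n < N" "T n \<noteq> 0" and least: "\<And>k. k < n \<Longrightarrow> T k = 0"
        using LeastI_ex[OF True] not_less_Least[of _ "\<lambda>k. k < N \<and> T k \<noteq> 0"] unfolding n_def[symmetric]
        by auto
      have "\<exists>a. a \<in> W n \<and> t - a \<in> A n"
      proof (rule ccontr)
        assume "\<not> ?thesis"
        then have "(\<lambda>a. indicator (W n) a * indicator (A n) (t - a) :: ennreal) = (\<lambda>a. 0)"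
          by (auto simp: fun_eq_iff split: split_indicator)
        then show False using n(2) by (simp add: T_def)
      qed
      then obtain a where a: "a \<in> W n" "t - a \<in> A n" by blast
      have "M t = (\<Sum>k\<in>{..<n} \<union> ({n} \<union> {n<..<N}). T k)"
        unfolding M_def T_def[symmetric] using n(1) by (intro sum.cong) auto
      also have "\<dots> = T n + (\<Sum>k\<in>{n<..<N}. T k)"
        by (subst sum.union_disjoint) (auto simp: least)
      also have "T n \<le> 1"
      proof -
        have "(\<integral>\<^sup>+a. indicator (W n) a * indicator (A n) (t - a) \<partial>\<mu>) \<le> (\<integral>\<^sup>+a. indicator (A n) (t + - a) \<partial>\<mu>)"
          by (intro nn_integral_mono) (auto split: split_indicator)
        also have "\<dots> = \<alpha> n"
          by (subst nn_integral_reflect[of "\<lambda>a. indicator (A n) (t + a)"])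
             (simp_all add: nn_integral_translate \<alpha>_def)
        finally have "T n \<le> \<alpha> n / \<alpha> n"
          unfolding T_def by (rule divide_right_mono_ennreal)
        then show ?thesis using \<alpha>[of n] by (simp add: ennreal_divide_self top.not_eq_extremum)
      qed
      also have "(\<Sum>k\<in>{n<..<N}. T k) \<le> crowding N W n a"
        unfolding crowding_def T_def \<alpha>_def
      proof (intro sum_mono divide_right_mono_ennreal nn_integral_mono)
        fix k b assume k: "k \<in> {n<..<N}"
        have "a - b \<in> earlier_diffs k" if "t - b \<in> A k"
        proof -
          have "a - b = (t - b) - (t - a)" by simp
          then show ?thesis unfolding earlier_diffs_def UN_iff mem_Collect_eq using that a k
            by (intro bexI[of _ n] exI[of _ "t - b"] exI[of _ "t - a"] conjI) auto
        qed
        then show "indicator (W k) b * indicator (A k) (t - b) \<le> (indicator (W k) b * indicator (earlier_diffs k) (a - b) :: ennreal)"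
          by (auto split: split_indicator)
      qed
      also have "\<dots> \<le> 1" using a W_eq[OF n(1)] by auto
      finally show ?thesis by simp
    qed
  qed
  \<comment> \<open>Sum the averages of \<open>\<Phi>\<close> over the kept translates and exchange the integrals.\<close>
  have "l * (\<Sum>n<N. emeasure \<mu> (W n)) = (\<Sum>n<N. l * emeasure \<mu> (W n))"
    by (simp add: sum_distrib_left)
  also have "\<dots> \<le> (\<Sum>n<N. (\<integral>\<^sup>+a. indicator (W n) a * (\<integral>\<^sup>+t. indicator (A n) t * \<Phi> (t + a) \<partial>\<mu>) \<partial>\<mu>) / \<alpha> n)"
  proof (rule sum_mono)
    fix n assume "n \<in> {..<N}"
    then have n: "n < N" by simp
    have "l * emeasure \<mu> (W n) = (l * emeasure \<mu> (W n)) * \<alpha> n / \<alpha> n"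
      using \<alpha>[of n] by (subst ennreal_mult_divide_eq) auto
    also have "(l * emeasure \<mu> (W n)) * \<alpha> n = (l * \<alpha> n) * emeasure \<mu> (W n)"
      by (simp only: mult_ac)
    also have "(l * \<alpha> n) * emeasure \<mu> (W n) / \<alpha> n = (\<integral>\<^sup>+a. indicator (W n) a * (l * \<alpha> n) \<partial>\<mu>) / \<alpha> n"
      by (subst nn_integral_multc) (simp_all add: mult.commute[of "emeasure \<mu> (W n)"])
    also have "\<dots> \<le> (\<integral>\<^sup>+a. indicator (W n) a * (\<integral>\<^sup>+t. indicator (A n) t * \<Phi> (t + a) \<partial>\<mu>) \<partial>\<mu>) / \<alpha> n"
      using large[OF n] W_eq[OF n] unfolding \<alpha>_def
      by (intro divide_right_mono_ennreal nn_integral_mono) (auto split: split_indicator)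
    finally show "l * emeasure \<mu> (W n) \<le> (\<integral>\<^sup>+a. indicator (W n) a * (\<integral>\<^sup>+t. indicator (A n) t * \<Phi> (t + a) \<partial>\<mu>) \<partial>\<mu>) / \<alpha> n" .
  qed
  also have "\<dots> = (\<Sum>n<N. (\<integral>\<^sup>+t. \<Phi> t * (\<integral>\<^sup>+a. indicator (W n) a * indicator (A n) (t - a) \<partial>\<mu>) \<partial>\<mu>) / \<alpha> n)"
  proof (intro sum.cong refl arg_cong2[where f="(/)"])
    fix n
    have "(\<integral>\<^sup>+t. indicator (A n) t * \<Phi> (t + a) \<partial>\<mu>) = (\<integral>\<^sup>+t. indicator (A n) (t - a) * \<Phi> t \<partial>\<mu>)" for a
      by (subst nn_integral_translate[of "\<lambda>t. indicator (A n) t * \<Phi> (t + a)" "-a", symmetric]) simp_all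
    then have "(\<integral>\<^sup>+a. indicator (W n) a * (\<integral>\<^sup>+t. indicator (A n) t * \<Phi> (t + a) \<partial>\<mu>) \<partial>\<mu>)
       = (\<integral>\<^sup>+a. (\<integral>\<^sup>+t. indicator (W n) a * (indicator (A n) (t - a) * \<Phi> t) \<partial>\<mu>) \<partial>\<mu>)"
      by (simp add: nn_integral_cmult)
    also have "\<dots> = (\<integral>\<^sup>+t. (\<integral>\<^sup>+a. indicator (W n) a * (indicator (A n) (t - a) * \<Phi> t) \<partial>\<mu>) \<partial>\<mu>)"
      by (rule pair.Fubini') measurable
    also have "\<dots> = (\<integral>\<^sup>+t. \<Phi> t * (\<integral>\<^sup>+a. indicator (W n) a * indicator (A n) (t - a) \<partial>\<mu>) \<partial>\<mu>)"
      by (subst nn_integral_cmult[symmetric]) (auto simp: mult_ac)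
    finally show "(\<integral>\<^sup>+a. indicator (W n) a * (\<integral>\<^sup>+t. indicator (A n) t * \<Phi> (t + a) \<partial>\<mu>) \<partial>\<mu>) = \<dots>" .
  qed
  also have "\<dots> = (\<integral>\<^sup>+t. \<Phi> t * M t \<partial>\<mu>)"
    unfolding M_def
    by (simp add: nn_integral_sum nn_integral_divide sum_distrib_left ennreal_times_divide)
  also have "\<dots> \<le> (\<integral>\<^sup>+t. \<Phi> t * 2 \<partial>\<mu>)"
    by (intro nn_integral_mono mult_left_mono M2) auto
  also have "\<dots> = 2 * (\<integral>\<^sup>+t. \<Phi> t \<partial>\<mu>)"
    by (simp add: nn_integral_multc mult.commute)
  finally have lW: "l * (\<Sum>n<N. emeasure \<mu> (W n)) \<le> 2 * (\<integral>\<^sup>+t. \<Phi> t \<partial>\<mu>)" .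
  have "l * (\<Sum>n<N. emeasure \<mu> (B n)) \<le> l * (ennreal (1 + C) * (\<Sum>k<N. emeasure \<mu> (W k)))"
    by (intro mult_left_mono BW) auto
  also have "\<dots> = ennreal (1 + C) * (l * (\<Sum>k<N. emeasure \<mu> (W k)))"
    by (simp add: mult_ac)
  also have "\<dots> \<le> ennreal (1 + C) * (2 * (\<integral>\<^sup>+t. \<Phi> t \<partial>\<mu>))"
    by (intro mult_left_mono lW) auto
  also have "\<dots> = ennreal (2 * (1 + C)) * (\<integral>\<^sup>+t. \<Phi> t \<partial>\<mu>)"
    using C_pos ennreal_mult[of 2 "1 + C"] by (simp add: mult_ac)
  finally show ?thesis .
qed

end

section \<open>The maximal inequality on the phase space\<close>

locale tempered_system = tempered_folner \<mu> A C + prob_space m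
  for \<mu> :: "'g::{topological_ab_group_add, t2_space, second_countable_topology} measure"
    and A C and m :: "'x measure" +
  fixes act :: "'g \<Rightarrow> 'x \<Rightarrow> 'x"
  assumes system: "measurable_dynamical_system act m"
begin

lemma measurable_act [measurable (raw)]:
  assumes [measurable]: "f \<in> borel_measurable M" "g \<in> measurable M m"
  shows "(\<lambda>y. act (f y) (g y)) \<in> measurable M m"
proof -
  have [measurable]: "(\<lambda>(t, x). act t x) \<in> measurable (borel \<Otimes>\<^sub>M m) m"
    using system by (simp add: measurable_dynamical_system_def)
  have "(\<lambda>y. (\<lambda>(t, x). act t x) (f y, g y)) \<in> measurable M m"
    by measurable
  then show ?thesis by simp
qed

lemma act_space [simp]: "x \<in> space m \<Longrightarrow> act t x \<in> space m"
  using measurable_space[OF measurable_act[of "\<lambda>_. t" m "\<lambda>x. x"]] by simp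

lemma act_add: "x \<in> space m \<Longrightarrow> act (s + t) x = act s (act t x)"
  using system by (simp add: measurable_dynamical_system_def)

lemma distr_act: "distr m m (act t) = m"
  using system by (simp add: measurable_dynamical_system_def)

lemma nn_integral_act:
  assumes [measurable]: "f \<in> borel_measurable m"
  shows "(\<integral>\<^sup>+x. f (act t x) \<partial>m) = (\<integral>\<^sup>+x. f x \<partial>m)"
  by (subst (2) distr_act[of t, symmetric]) (simp add: nn_integral_distr)

lemma integral_act:
  fixes f :: "'x \<Rightarrow> 'b::{banach, second_countable_topology}"
  assumes [measurable]: "f \<in> borel_measurable m"
  shows "(\<integral>x. f (act t x) \<partial>m) = (\<integral>x. f x \<partial>m)"
  by (subst (2) distr_act[of t, symmetric]) (simp add: integral_distr)

text \<open>
  The uniform distribution on \<open>A n\<close>: averages become integrals over a probability space.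
\<close>

definition \<nu> :: "nat \<Rightarrow> 'g measure" where "\<nu> n = uniform_measure \<mu> (A n)"

lemma sets_\<nu> [measurable_cong, simp]: "sets (\<nu> n) = sets borel"
  by (simp add: \<nu>_def)

lemma space_\<nu> [simp]: "space (\<nu> n) = UNIV"
  by (simp add: \<nu>_def)

lemma prob_space_\<nu>: "prob_space (\<nu> n)"
  unfolding \<nu>_def using emeasure_A[of n] measure_A_pos[of n]
  by (intro prob_space_uniform_measure) auto

sublocale sys: pair_sigma_finite m \<mu> ..

lemma nn_integral_\<nu>:
  assumes [measurable]: "f \<in> borel_measurable borel"
  shows "(\<integral>\<^sup>+t. f t \<partial>\<nu> n) = (\<integral>\<^sup>+t. indicator (A n) t * f t \<partial>\<mu>) / emeasure \<mu> (A n)"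
  unfolding \<nu>_def by (subst nn_integral_uniform_measure) (auto simp: mult.commute)

text \<open>
  Transference. Apply the covering theorem along each orbit, to base points in the window \<open>- A N\<close> and to
  \<open>t \<mapsto> f (t.x)\<close> cut off outside \<open>- earlier_diffs N\<close>. This choice of window fits temperedness:
  the translates of \<open>A n\<close> with \<open>n < N\<close> based in \<open>- A N\<close> stay inside \<open>- earlier_diffs N\<close>, which is at
  most \<open>C\<close> times larger than the window. Integrating over \<open>x\<close> and using invariance of the measure
  gives the inequality.
\<close>

theorem weak_maximal_inequality_finite:
  fixes f :: "'x \<Rightarrow> ennreal"
  assumes [measurable]: "f \<in> borel_measurable m"
  shows "l * emeasure m {x \<in> space m. \<exists>n<N. l < (\<integral>\<^sup>+t. f (act t x) \<partial>\<nu> n)}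
     \<le> ennreal (2 * (1 + C) * C) * (\<integral>\<^sup>+x. f x \<partial>m)"
proof -
  define \<alpha> where "\<alpha> n = emeasure \<mu> (A n)" for n
  have \<alpha>: "\<alpha> n \<noteq> 0" "\<alpha> n \<noteq> \<top>" for n
    using emeasure_A[of n] measure_A_pos[of n] by (auto simp: \<alpha>_def)
  interpret \<nu>: prob_space "\<nu> n" for n by (rule prob_space_\<nu>)
  define av where "av n x = (\<integral>\<^sup>+t. f (act t x) \<partial>\<nu> n)" for n x
  have av_meas [measurable]: "av n \<in> borel_measurable m" for n
    unfolding av_def by measurable
  \<comment> \<open>Splitting by the first index at which the average exceeds \<open>l\<close> makes the base point sets disjoint.\<close>
  define Y where "Y n = {x \<in> space m. l < av n x \<and> (\<forall>k<n. \<not> l < av k x)}" for n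
  have Y [measurable]: "Y n \<in> sets m" for n
    unfolding Y_def by measurable
  have disjY: "disjoint_family Y"
    unfolding disjoint_family_on_def Y_def by (auto) (metis linorder_neqE_nat)
  have UY: "{x \<in> space m. \<exists>n<N. l < av n x} = (\<Union>n<N. Y n)"
  proof (intro equalityI subsetI)
    fix x assume x: "x \<in> {x \<in> space m. \<exists>n<N. l < av n x}"
    define n where "n = (LEAST n. l < av n x)"
    from x obtain k where k: "k < N" "l < av k x" by blast
    have "l < av n x" "\<And>j. j < n \<Longrightarrow> \<not> l < av j x" "n \<le> k"
      using LeastI[of "\<lambda>n. l < av n x"] k not_less_Least[of _ "\<lambda>n. l < av n x"]
        Least_le[of "\<lambda>n. l < av n x"]
      unfolding n_def[symmetric] by blast+
    then show "x \<in> (\<Union>n<N. Y n)" using x k by (auto simp: Y_def)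
  qed (auto simp: Y_def)
  define B where "B x n = {a. - a \<in> A N \<and> act a x \<in> Y n}" for x n
  define Q where "Q n = {p \<in> space (m \<Otimes>\<^sub>M \<mu>). - snd p \<in> A N \<and> act (snd p) (fst p) \<in> Y n}" for n
  have Q [measurable]: "Q n \<in> sets (m \<Otimes>\<^sub>M \<mu>)" for n
    unfolding Q_def by measurable
  have B_eq: "B x n = Pair x -` Q n" if "x \<in> space m" for x n
    using that by (auto simp: B_def Q_def space_pair_measure)
  have B_sets: "B x n \<in> sets borel" if "x \<in> space m" for x n
    using sets_Pair1[OF Q, of x n] that by (simp add: B_eq)
  have B_meas [measurable]: "(\<lambda>x. emeasure \<mu> (B x n)) \<in> borel_measurable m" for n
    using sys.measurable_emeasure_Pair1[OF Q, of n] by (simp add: B_eq cong: measurable_cong)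
  define \<Phi> where "\<Phi> x t = indicator (earlier_diffs N) (- t) * f (act t x)" for x t
  have covering: "l * (\<Sum>n<N. emeasure \<mu> (B x n)) \<le> ennreal (2 * (1 + C)) * (\<integral>\<^sup>+t. \<Phi> x t \<partial>\<mu>)"
    if x [measurable]: "x \<in> space m" for x
  proof (rule weighted_covering)
    show "B x n \<in> sets borel" for n
      by (rule B_sets[OF x])
    show "disjoint_family (B x)"
      using disjY unfolding disjoint_family_on_def B_def by blast
    show "\<Phi> x \<in> borel_measurable borel"
      unfolding \<Phi>_def by measurable
    fix n a assume n: "n < N" and a: "a \<in> B x n"
    have "l \<le> av n (act a x)" using a by (auto simp: B_def Y_def)
    also have "\<dots> = (\<integral>\<^sup>+t. indicator (A n) t * f (act t (act a x)) \<partial>\<mu>) / \<alpha> n"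
      unfolding av_def \<alpha>_def using x by (intro nn_integral_\<nu>) simp
    finally have "l * \<alpha> n \<le> (\<integral>\<^sup>+t. indicator (A n) t * f (act t (act a x)) \<partial>\<mu>) / \<alpha> n * \<alpha> n"
      by (intro mult_right_mono) auto
    also have "\<dots> = (\<integral>\<^sup>+t. indicator (A n) t * f (act t (act a x)) \<partial>\<mu>)"
      using \<alpha>[of n] by (simp add: ennreal_divide_times top.not_eq_extremum)
    also have "\<dots> = (\<integral>\<^sup>+t. indicator (A n) t * \<Phi> x (t + a) \<partial>\<mu>)"
    proof (rule nn_integral_cong)
      fix t
      have "- (t + a) \<in> earlier_diffs N" if "t \<in> A n"
      proof -
        have "- (t + a) = - a - t" by simp
        then show ?thesis unfolding earlier_diffs_def UN_iff mem_Collect_eq using that a n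
          by (intro bexI[of _ n] exI[of _ "- a"] exI[of _ t] conjI) (auto simp: B_def)
      qed
      then show "indicator (A n) t * f (act t (act a x)) = indicator (A n) t * \<Phi> x (t + a)"
        using x by (auto simp: \<Phi>_def act_add split: split_indicator)
    qed
    finally show "l * emeasure \<mu> (A n) \<le> (\<integral>\<^sup>+t. indicator (A n) t * \<Phi> x (t + a) \<partial>\<mu>)"
      by (simp add: \<alpha>_def)
  qed
  have uAN: "(\<integral>\<^sup>+a. indicator (S) (- a) \<partial>\<mu>) = emeasure \<mu> S" if [measurable]: "S \<in> sets borel" for S
    by (subst nn_integral_reflect) auto
  have lhs: "(\<integral>\<^sup>+x. emeasure \<mu> (B x n) \<partial>m) = \<alpha> N * emeasure m (Y n)" for n
  proof -
    have "(\<integral>\<^sup>+x. emeasure \<mu> (B x n) \<partial>m) = (\<integral>\<^sup>+x. (\<integral>\<^sup>+a. indicator (A N) (- a) * indicator (Y n) (act a x) \<partial>\<mu>) \<partial>m)"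
    proof (intro nn_integral_cong)
      fix x assume x: "x \<in> space m"
      have "emeasure \<mu> (B x n) = (\<integral>\<^sup>+a. indicator (B x n) a \<partial>\<mu>)"
        using B_sets[OF x] by simp
      also have "\<dots> = (\<integral>\<^sup>+a. indicator (A N) (- a) * indicator (Y n) (act a x) \<partial>\<mu>)"
        by (intro nn_integral_cong) (auto simp: B_def split: split_indicator)
      finally show "emeasure \<mu> (B x n) = \<dots>" .
    qed
    also have "\<dots> = (\<integral>\<^sup>+a. (\<integral>\<^sup>+x. indicator (A N) (- a) * indicator (Y n) (act a x) \<partial>m) \<partial>\<mu>)"
      by (rule sys.Fubini'[symmetric]) measurable
    also have "\<dots> = (\<integral>\<^sup>+a. indicator (A N) (- a) * emeasure m (Y n) \<partial>\<mu>)"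
      by (simp add: nn_integral_cmult nn_integral_act)
    also have "\<dots> = \<alpha> N * emeasure m (Y n)"
      by (simp add: nn_integral_multc uAN \<alpha>_def)
    finally show ?thesis .
  qed
  have "(l * emeasure m (\<Union>n<N. Y n)) * \<alpha> N = l * (\<Sum>n<N. \<alpha> N * emeasure m (Y n))"
  proof -
    have "(\<Sum>n<N. emeasure m (Y n)) = emeasure m (\<Union>n<N. Y n)"
      using disjY by (intro sum_emeasure) (auto simp: disjoint_family_on_def)
    then show ?thesis by (simp add: sum_distrib_left[symmetric] mult_ac)
  qed
  also have "\<dots> = (\<integral>\<^sup>+x. l * (\<Sum>n<N. emeasure \<mu> (B x n)) \<partial>m)"
    by (simp add: nn_integral_cmult nn_integral_sum lhs)
  also have "\<dots> \<le> (\<integral>\<^sup>+x. ennreal (2 * (1 + C)) * (\<integral>\<^sup>+t. \<Phi> x t \<partial>\<mu>) \<partial>m)"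
    by (intro nn_integral_mono covering)
  also have "\<dots> = ennreal (2 * (1 + C)) * (\<integral>\<^sup>+x. (\<integral>\<^sup>+t. \<Phi> x t \<partial>\<mu>) \<partial>m)"
    unfolding \<Phi>_def by (rule nn_integral_cmult) measurable
  also have "(\<integral>\<^sup>+x. (\<integral>\<^sup>+t. \<Phi> x t \<partial>\<mu>) \<partial>m) = (\<integral>\<^sup>+t. (\<integral>\<^sup>+x. \<Phi> x t \<partial>m) \<partial>\<mu>)"
    unfolding \<Phi>_def by (rule sys.Fubini'[symmetric]) measurable
  also have "\<dots> = (\<integral>\<^sup>+t. indicator (earlier_diffs N) (- t) * (\<integral>\<^sup>+x. f x \<partial>m) \<partial>\<mu>)"
    unfolding \<Phi>_def by (simp add: nn_integral_cmult nn_integral_act)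
  also have "\<dots> = emeasure \<mu> (earlier_diffs N) * (\<integral>\<^sup>+x. f x \<partial>m)"
    by (simp add: nn_integral_multc uAN)
  also have "ennreal (2 * (1 + C)) * (emeasure \<mu> (earlier_diffs N) * (\<integral>\<^sup>+x. f x \<partial>m))
     \<le> ennreal (2 * (1 + C)) * ((ennreal C * \<alpha> N) * (\<integral>\<^sup>+x. f x \<partial>m))"
    unfolding \<alpha>_def by (intro mult_left_mono mult_right_mono emeasure_earlier_diffs) auto
  also have "\<dots> = (ennreal (2 * (1 + C) * C) * (\<integral>\<^sup>+x. f x \<partial>m)) * \<alpha> N"
    using C_pos ennreal_mult[of "2 * (1 + C)" C] by (simp add: mult_ac)
  finally have le: "(l * emeasure m (\<Union>n<N. Y n)) * \<alpha> N
      \<le> (ennreal (2 * (1 + C) * C) * (\<integral>\<^sup>+x. f x \<partial>m)) * \<alpha> N" .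
  have "l * emeasure m (\<Union>n<N. Y n) = (l * emeasure m (\<Union>n<N. Y n)) * \<alpha> N / \<alpha> N"
    using ennreal_mult_divide_eq[OF \<alpha>[of N]] by simp
  also have "\<dots> \<le> (ennreal (2 * (1 + C) * C) * (\<integral>\<^sup>+x. f x \<partial>m)) * \<alpha> N / \<alpha> N"
    by (intro divide_right_mono_ennreal le)
  also have "\<dots> = ennreal (2 * (1 + C) * C) * (\<integral>\<^sup>+x. f x \<partial>m)"
    using ennreal_mult_divide_eq[OF \<alpha>[of N]] by simp
  finally show ?thesis by (simp only: UY[symmetric] av_def)
qed

theorem weak_maximal_inequality:
  fixes f :: "'x \<Rightarrow> ennreal"
  assumes [measurable]: "f \<in> borel_measurable m"
  shows "l * emeasure m {x \<in> space m. \<exists>n. l < (\<integral>\<^sup>+t. f (act t x) \<partial>\<nu> n)}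
     \<le> ennreal (2 * (1 + C) * C) * (\<integral>\<^sup>+x. f x \<partial>m)"
proof -
  interpret \<nu>: prob_space "\<nu> n" for n by (rule prob_space_\<nu>)
  define Z where "Z N = {x \<in> space m. \<exists>n<N. l < (\<integral>\<^sup>+t. f (act t x) \<partial>\<nu> n)}" for N
  have [measurable]: "Z N \<in> sets m" for N
    unfolding Z_def by measurable
  have "{x \<in> space m. \<exists>n. l < (\<integral>\<^sup>+t. f (act t x) \<partial>\<nu> n)} = (\<Union>N. Z N)"
    by (auto simp: Z_def)
  moreover have "emeasure m (\<Union>N. Z N) = (SUP N. emeasure m (Z N))"
    by (intro SUP_emeasure_incseq[symmetric]) (auto simp: incseq_def Z_def image_subset_iff[symmetric] intro: less_le_trans)
  ultimately show ?thesis
    unfolding Z_def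
    by (simp only: SUP_mult_left_ennreal) (intro SUP_least weak_maximal_inequality_finite assms)
qed

end

section \<open>Averages of bounded functions along the sequence\<close>

lemma borel_measurable_cnj [measurable (raw)]:
  assumes "f \<in> borel_measurable M" shows "(\<lambda>x. cnj (f x)) \<in> borel_measurable M"
  by (rule borel_measurable_continuous_on[OF _ assms]) (intro continuous_intros)

lemma norm_integral_le_integral:
  fixes f :: "'a \<Rightarrow> 'b::{banach, second_countable_topology}"
  assumes "integrable M f" "integrable M g" "\<And>x. x \<in> space M \<Longrightarrow> norm (f x) \<le> g x"
  shows "norm (\<integral>x. f x \<partial>M) \<le> (\<integral>x. g x \<partial>M)"
proof -
  have "norm (\<integral>x. f x \<partial>M) \<le> (\<integral>x. norm (f x) \<partial>M)" by simp
  also have "\<dots> \<le> (\<integral>x. g x \<partial>M)" using assms by (intro integral_mono integrable_norm)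
  finally show ?thesis .
qed

context prob_space begin

lemma integrable_bounded:
  fixes f :: "'a \<Rightarrow> 'b::{banach, second_countable_topology}"
  assumes "f \<in> borel_measurable M" "\<And>x. x \<in> space M \<Longrightarrow> norm (f x) \<le> B"
  shows "integrable M f"
  using assms by (intro integrable_const_bound[where B=B]) auto

lemma norm_integral_le_bound:
  fixes f :: "'a \<Rightarrow> 'b::{banach, second_countable_topology}"
  assumes "f \<in> borel_measurable M" "\<And>x. x \<in> space M \<Longrightarrow> norm (f x) \<le> B"
  shows "norm (\<integral>x. f x \<partial>M) \<le> B"
proof -
  have "norm (\<integral>x. f x \<partial>M) \<le> (\<integral>x. norm (f x) \<partial>M)" by simp
  also have "\<dots> \<le> (\<integral>x. B \<partial>M)"
    using assms by (intro integral_mono integrable_norm integrable_bounded) auto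
  finally show ?thesis by (simp add: prob_space)
qed

lemma norm_integral_square_le:
  fixes f :: "'a \<Rightarrow> 'b::{banach, second_countable_topology}"
  assumes [measurable]: "f \<in> borel_measurable M" and B: "\<And>x. x \<in> space M \<Longrightarrow> norm (f x) \<le> B"
  shows "(norm (\<integral>x. f x \<partial>M))\<^sup>2 \<le> (\<integral>x. (norm (f x))\<^sup>2 \<partial>M)"
proof -
  define c where "c = (\<integral>x. norm (f x) \<partial>M)"
  have i1: "integrable M (\<lambda>x. norm (f x))"
    using B by (intro integrable_norm integrable_bounded) auto
  have i2: "integrable M (\<lambda>x. (norm (f x))\<^sup>2)"
    using B by (intro integrable_bounded[where B="B\<^sup>2"]) (auto intro: power_mono)
  have "0 \<le> (\<integral>x. (norm (f x) - c)\<^sup>2 \<partial>M)"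
    by (intro integral_nonneg_AE) auto
  also have "\<dots> = (\<integral>x. (norm (f x))\<^sup>2 - 2 * c * norm (f x) + c\<^sup>2 \<partial>M)"
    by (intro Bochner_Integration.integral_cong refl) (simp add: power2_eq_square algebra_simps)
  also have "\<dots> = (\<integral>x. (norm (f x))\<^sup>2 \<partial>M) - c\<^sup>2"
    using i1 i2 by (simp add: prob_space c_def[symmetric] power2_eq_square)
  finally have "c\<^sup>2 \<le> (\<integral>x. (norm (f x))\<^sup>2 \<partial>M)" by simp
  moreover have "(norm (\<integral>x. f x \<partial>M))\<^sup>2 \<le> c\<^sup>2"
    unfolding c_def by (intro power_mono) auto
  ultimately show ?thesis by linarith
qed

end

lemma Fubini_bounded:
  fixes f :: "'a \<Rightarrow> 'b \<Rightarrow> 'c::{banach, second_countable_topology}"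
  assumes "prob_space M1" "prob_space M2"
    and [measurable]: "case_prod f \<in> borel_measurable (M1 \<Otimes>\<^sub>M M2)"
    and B: "\<And>x y. x \<in> space M1 \<Longrightarrow> y \<in> space M2 \<Longrightarrow> norm (f x y) \<le> B"
  shows "(\<integral>y. (\<integral>x. f x y \<partial>M1) \<partial>M2) = (\<integral>x. (\<integral>y. f x y \<partial>M2) \<partial>M1)"
    and "integrable (M1 \<Otimes>\<^sub>M M2) (case_prod f)"
proof -
  interpret M1: prob_space M1 by fact
  interpret M2: prob_space M2 by fact
  interpret P: pair_prob_space M1 M2 ..
  show "integrable (M1 \<Otimes>\<^sub>M M2) (case_prod f)"
    using B by (intro P.integrable_bounded[where B=B]) (auto simp: space_pair_measure)
  then show "(\<integral>y. (\<integral>x. f x y \<partial>M1) \<partial>M2) = (\<integral>x. (\<integral>y. f x y \<partial>M2) \<partial>M1)"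
    by (rule P.Fubini_integral)
qed

lemma dual_groupD:
  assumes "\<xi> \<in> dual_group"
  shows "\<xi> \<in> borel_measurable borel" "norm (\<xi> t) = 1" "\<xi> (s + t) = \<xi> s * \<xi> t"
    and "\<xi> t * cnj (\<xi> t) = 1"
proof -
  show 1: "\<xi> \<in> borel_measurable borel" "norm (\<xi> t) = 1" and 2: "\<xi> (s + t) = \<xi> s * \<xi> t"
    using assms by (auto simp: dual_group_def intro: borel_measurable_continuous_onI)
  show "\<xi> t * cnj (\<xi> t) = 1" using 1(2) complex_norm_square[of "\<xi> t"] by simp
qed

context tempered_system begin

sublocale \<nu>: prob_space "\<nu> n" for n by (rule prob_space_\<nu>)

lemma integral_\<nu>:
  fixes f :: "'g \<Rightarrow> 'b::{banach, second_countable_topology}"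
  assumes [measurable]: "f \<in> borel_measurable borel"
  shows "(\<integral>t. f t \<partial>\<nu> n) = (\<integral>t. indicator (A n) t *\<^sub>R f t \<partial>\<mu>) /\<^sub>R measure \<mu> (A n)"
    and "integrable (\<nu> n) f \<longleftrightarrow> integrable \<mu> (\<lambda>t. indicator (A n) t *\<^sub>R f t)"
proof -
  have *: "(indicator (A n) t / emeasure \<mu> (A n)) = ennreal (indicator (A n) t / measure \<mu> (A n))" for t
    using measure_A_pos[of n] by (auto simp: emeasure_A divide_ennreal[symmetric] split: split_indicator)
  have "(\<integral>t. f t \<partial>\<nu> n) = (\<integral>t. (indicator (A n) t / measure \<mu> (A n)) *\<^sub>R f t \<partial>\<mu>)"
    unfolding \<nu>_def uniform_measure_def * by (intro integral_density) auto
  also have "\<dots> = (\<integral>t. (1 / measure \<mu> (A n)) *\<^sub>R (indicator (A n) t *\<^sub>R f t) \<partial>\<mu>)"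
    by simp
  also have "\<dots> = (\<integral>t. indicator (A n) t *\<^sub>R f t \<partial>\<mu>) /\<^sub>R measure \<mu> (A n)"
    by (subst integral_scaleR_right) (simp add: field_simps)
  finally show "(\<integral>t. f t \<partial>\<nu> n) = (\<integral>t. indicator (A n) t *\<^sub>R f t \<partial>\<mu>) /\<^sub>R measure \<mu> (A n)" .
  have "integrable (\<nu> n) f \<longleftrightarrow> integrable \<mu> (\<lambda>t. (indicator (A n) t / measure \<mu> (A n)) *\<^sub>R f t)"
    unfolding \<nu>_def uniform_measure_def * by (intro integrable_density) auto
  also have "\<dots> \<longleftrightarrow> integrable \<mu> (\<lambda>t. indicator (A n) t *\<^sub>R f t)"
  proof
    assume "integrable \<mu> (\<lambda>t. (indicator (A n) t / measure \<mu> (A n)) *\<^sub>R f t)"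
    from integrable_scaleR_right[OF this, of "measure \<mu> (A n)"]
    show "integrable \<mu> (\<lambda>t. indicator (A n) t *\<^sub>R f t)"
      using measure_A_pos[of n] by simp
  next
    assume "integrable \<mu> (\<lambda>t. indicator (A n) t *\<^sub>R f t)"
    from integrable_scaleR_right[OF this, of "1 / measure \<mu> (A n)"]
    show "integrable \<mu> (\<lambda>t. (indicator (A n) t / measure \<mu> (A n)) *\<^sub>R f t)"
      by simp
  qed
  finally show "integrable (\<nu> n) f \<longleftrightarrow> integrable \<mu> (\<lambda>t. indicator (A n) t *\<^sub>R f t)" .
qed

text \<open>
  The relative size of \<open>A n \<triangle> (t + A n)\<close>, which the Folner condition sends to 0.
\<close>

definition folner_defect :: "nat \<Rightarrow> 'g \<Rightarrow> real" where
  "folner_defect n t = measure \<mu> (sym_diff (A n) ((+) t ` A n)) / measure \<mu> (A n)"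

lemma folner_defect_tendsto: "(\<lambda>n. folner_defect n t) \<longlonglongrightarrow> 0"
  using folner by (auto simp: folner_sequence_def folner_defect_def)

lemma indicator_translate: "indicator ((+) (t::'g) ` S) s = (indicator S (s - t) :: 'b::zero_neq_one)"
  by (auto simp: indicator_def image_iff algebra_simps intro!: bexI[of _ "s - t"])

lemma sets_translate [measurable]:
  assumes [measurable]: "S \<in> sets borel" shows "(+) (t::'g) ` S \<in> sets borel"
proof -
  have "(+) t ` S = {s \<in> space borel. s - t \<in> S}"
    by (auto simp: image_iff algebra_simps intro!: bexI[of _ "_ - t"])
  also have "\<dots> \<in> sets borel" by measurable
  finally show ?thesis .
qed

lemma integrable_A: "integrable \<mu> (\<lambda>s. indicator (A n) (s - t) :: real)"
  and integral_A: "(\<integral>s. indicator (A n) (s - t) \<partial>\<mu>) = measure \<mu> (A n)"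
proof -
  have e: "emeasure \<mu> ((+) t ` A n) = ennreal (measure \<mu> (A n))"
    by (simp add: emeasure_translate emeasure_A)
  then have "integrable \<mu> (indicator ((+) t ` A n) :: _ \<Rightarrow> real)"
    by (intro integrable_real_indicator) auto
  then show "integrable \<mu> (\<lambda>s. indicator (A n) (s - t) :: real)"
    by (simp add: indicator_translate[abs_def])
  have "(\<integral>s. indicator (A n) (s - t) \<partial>\<mu>) = (\<integral>s. (indicator ((+) t ` A n) s :: real) \<partial>\<mu>)"
    by (simp add: indicator_translate)
  also have "\<dots> = measure \<mu> ((+) t ` A n)" by simp
  finally show "(\<integral>s. indicator (A n) (s - t) \<partial>\<mu>) = measure \<mu> (A n)"
    using e by (simp add: measure_def)
qed

text \<open>
  In this form the dependence on \<open>t\<close> is visibly measurable.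
\<close>

lemma folner_defect_eq: "folner_defect n t = (\<integral>s. \<bar>indicator (A n) (s - t) - indicator (A n) s\<bar> \<partial>\<mu>) / measure \<mu> (A n)"
proof -
  have "measure \<mu> (sym_diff (A n) ((+) t ` A n)) = (\<integral>s. indicator (sym_diff (A n) ((+) t ` A n)) s \<partial>\<mu>)"
    by simp
  also have "\<dots> = (\<integral>s. \<bar>indicator (A n) (s - t) - indicator (A n) s\<bar> \<partial>\<mu>)"
    unfolding indicator_translate[symmetric]
    by (intro Bochner_Integration.integral_cong refl) (auto split: split_indicator)
  finally show ?thesis by (simp add: folner_defect_def)
qed

lemma folner_defect_measurable [measurable]: "folner_defect n \<in> borel_measurable borel"
  unfolding folner_defect_eq[abs_def] by measurable

lemma folner_defect_bounds: "0 \<le> folner_defect n t" "folner_defect n t \<le> 2"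
proof -
  show "0 \<le> folner_defect n t" by (simp add: folner_defect_def)
  have "(\<integral>s. \<bar>indicator (A n) (s - t) - indicator (A n) s :: real\<bar> \<partial>\<mu>)
      \<le> (\<integral>s. indicator (A n) (s - t) + indicator (A n) (s - 0) \<partial>\<mu>)"
    using integrable_A[of n t] integrable_A[of n 0]
    by (intro integral_mono Bochner_Integration.integrable_add integrable_abs Bochner_Integration.integrable_diff)
       (auto split: split_indicator)
  also have "\<dots> = 2 * measure \<mu> (A n)"
    using integrable_A[of n t] integrable_A[of n 0]
    by (subst Bochner_Integration.integral_add) (simp_all add: integral_A integral_A[of n 0, simplified])
  finally show "folner_defect n t \<le> 2"
    using measure_A_pos[of n] by (simp add: folner_defect_eq divide_le_eq)
qed

text \<open>
  \<open>mean_defect n k\<close> measures how far averaging over \<open>A n\<close> is from absorbing a previous averaging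
  over \<open>A k\<close>.
\<close>

definition mean_defect :: "nat \<Rightarrow> nat \<Rightarrow> real" where
  "mean_defect n k = (\<integral>t. folner_defect n t \<partial>\<nu> k)"

lemma mean_defect_tendsto: "(\<lambda>n. mean_defect n k) \<longlonglongrightarrow> 0"
proof -
  have "(\<lambda>n. \<integral>t. folner_defect n t \<partial>\<nu> k) \<longlonglongrightarrow> (\<integral>t. 0 \<partial>\<nu> k)"
    using folner_defect_bounds by (intro integral_dominated_convergence[where w="\<lambda>_. 2"]) (auto simp: folner_defect_tendsto)
  then show ?thesis by (simp add: mean_defect_def)
qed

lemma average_translate:
  fixes h :: "'g \<Rightarrow> complex"
  assumes [measurable]: "h \<in> borel_measurable borel" and M: "\<And>t. norm (h t) \<le> M"
  shows "norm ((\<integral>s. h (t + s) \<partial>\<nu> n) - (\<integral>s. h s \<partial>\<nu> n)) \<le> M * folner_defect n t"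
proof -
  have i: "integrable \<mu> (\<lambda>s. indicator (A n) (s - t) *\<^sub>R h s)" for t
    using M by (intro Bochner_Integration.integrable_bound[OF integrable_mult_right[OF integrable_A[of n t], of M]])
       (auto split: split_indicator intro!: order_trans[OF M])
  have "(\<integral>s. h (t + s) \<partial>\<nu> n) = (\<integral>s. indicator (A n) s *\<^sub>R h (t + s) \<partial>\<mu>) /\<^sub>R measure \<mu> (A n)"
    by (intro integral_\<nu>) measurable
  also have "(\<integral>s. indicator (A n) s *\<^sub>R h (t + s) \<partial>\<mu>) = (\<integral>s. indicator (A n) (s - t) *\<^sub>R h s \<partial>\<mu>)"
    by (subst integral_translate[of "\<lambda>s. indicator (A n) (s - t) *\<^sub>R h s" t, symmetric]) simp_all
  finally have 1: "(\<integral>s. h (t + s) \<partial>\<nu> n) = (\<integral>s. indicator (A n) (s - t) *\<^sub>R h s \<partial>\<mu>) /\<^sub>R measure \<mu> (A n)" .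
  have "(\<integral>s. h (t + s) \<partial>\<nu> n) - (\<integral>s. h s \<partial>\<nu> n)
     = ((\<integral>s. indicator (A n) (s - t) *\<^sub>R h s \<partial>\<mu>) - (\<integral>s. indicator (A n) s *\<^sub>R h s \<partial>\<mu>)) /\<^sub>R measure \<mu> (A n)"
    unfolding 1 by (subst integral_\<nu>) (simp_all add: scaleR_right_diff_distrib)
  also have "(\<integral>s. indicator (A n) (s - t) *\<^sub>R h s \<partial>\<mu>) - (\<integral>s. indicator (A n) s *\<^sub>R h s \<partial>\<mu>)
    = (\<integral>s. (indicator (A n) (s - t) - indicator (A n) s) *\<^sub>R h s \<partial>\<mu>)"
    using i[of t] i[of 0] by (simp add: scaleR_left_diff_distrib)
  also have "norm (\<dots> /\<^sub>R measure \<mu> (A n)) \<le> (M * (\<integral>s. \<bar>indicator (A n) (s - t) - indicator (A n) s\<bar> \<partial>\<mu>)) / measure \<mu> (A n)"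
  proof -
    have "norm (\<integral>s. (indicator (A n) (s - t) - indicator (A n) s) *\<^sub>R h s \<partial>\<mu>)
       \<le> (\<integral>s. M * \<bar>indicator (A n) (s - t) - indicator (A n) s\<bar> \<partial>\<mu>)"
    proof (rule norm_integral_le_integral)
      show "integrable \<mu> (\<lambda>s. (indicator (A n) (s - t) - indicator (A n) s) *\<^sub>R h s)"
        using i[of t] i[of 0] by (simp add: scaleR_left_diff_distrib)
      show "integrable \<mu> (\<lambda>s. M * \<bar>indicator (A n) (s - t) - indicator (A n) s\<bar>)"
        using integrable_A[of n t] integrable_A[of n 0] by simp
      show "norm ((indicator (A n) (s - t) - indicator (A n) s) *\<^sub>R h s) \<le> M * \<bar>indicator (A n) (s - t) - indicator (A n) s\<bar>" for s
        using M[of s] by (auto split: split_indicator)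
    qed
    then show ?thesis
      using measure_A_pos[of n] by (simp add: divide_inverse mult.commute mult_right_mono)
  qed
  finally show ?thesis by (simp add: folner_defect_eq)
qed

text \<open>
  Exchange the two averages; for each fixed \<open>t\<close> only the Folner defect at \<open>t\<close> is lost.
\<close>

lemma average_average:
  fixes h :: "'g \<Rightarrow> complex"
  assumes [measurable]: "h \<in> borel_measurable borel" and M: "\<And>t. norm (h t) \<le> M"
  shows "norm ((\<integral>s. (\<integral>t. h (t + s) \<partial>\<nu> k) \<partial>\<nu> n) - (\<integral>s. h s \<partial>\<nu> n)) \<le> M * mean_defect n k"
proof -
  have "(\<integral>s. (\<integral>t. h (t + s) \<partial>\<nu> k) \<partial>\<nu> n) = (\<integral>t. (\<integral>s. h (t + s) \<partial>\<nu> n) \<partial>\<nu> k)"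
    using M by (intro Fubini_bounded[where B=M] prob_space_\<nu>) auto
  moreover have "(\<integral>t. (\<integral>s. h (t + s) \<partial>\<nu> n) - (\<integral>s. h s \<partial>\<nu> n) \<partial>\<nu> k)
      = (\<integral>t. (\<integral>s. h (t + s) \<partial>\<nu> n) \<partial>\<nu> k) - (\<integral>s. h s \<partial>\<nu> n)"
  proof (subst Bochner_Integration.integral_diff)
    show "integrable (\<nu> k) (\<lambda>t. \<integral>s. h (t + s) \<partial>\<nu> n)"
      using M by (intro \<nu>.integrable_bounded[where B=M] \<nu>.norm_integral_le_bound) auto
  qed (simp_all add: \<nu>.prob_space[simplified])
  moreover have "norm (\<integral>t. (\<integral>s. h (t + s) \<partial>\<nu> n) - (\<integral>s. h s \<partial>\<nu> n) \<partial>\<nu> k) \<le> (\<integral>t. M * folner_defect n t \<partial>\<nu> k)"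
  proof (rule norm_integral_le_integral)
    show "norm ((\<integral>s. h (t + s) \<partial>\<nu> n) - (\<integral>s. h s \<partial>\<nu> n)) \<le> M * folner_defect n t" for t
      using M by (intro average_translate) auto
    show "integrable (\<nu> k) (\<lambda>t. M * folner_defect n t)"
      using folner_defect_bounds by (intro integrable_mult_right \<nu>.integrable_bounded[where B=2]) auto
    show "integrable (\<nu> k) (\<lambda>t. (\<integral>s. h (t + s) \<partial>\<nu> n) - (\<integral>s. h s \<partial>\<nu> n))"
      using M by (intro Bochner_Integration.integrable_diff \<nu>.integrable_bounded[where B=M] \<nu>.norm_integral_le_bound) auto
  qed
  ultimately show ?thesis by (simp add: mean_defect_def)
qed

text \<open>
  Only values on \<open>space m\<close> are constrained, because the phase space need not be the whole type.
\<close>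

definition bdd_by :: "real \<Rightarrow> ('x \<Rightarrow> complex) \<Rightarrow> bool" where
  "bdd_by M f \<longleftrightarrow> f \<in> borel_measurable m \<and> (\<forall>x\<in>space m. norm (f x) \<le> M)"

lemma bdd_byD: "bdd_by M f \<Longrightarrow> f \<in> borel_measurable m" "bdd_by M f \<Longrightarrow> x \<in> space m \<Longrightarrow> norm (f x) \<le> M"
  by (auto simp: bdd_by_def)

lemma bdd_by_nonneg: "bdd_by M f \<Longrightarrow> 0 \<le> M"
  using not_empty by (auto simp: bdd_by_def intro: order_trans[OF norm_ge_zero])

lemma bdd_by_integrable: "bdd_by M f \<Longrightarrow> integrable m f"
  by (rule integrable_bounded) (auto simp: bdd_by_def)

lemma bdd_by_integrable_square: "bdd_by M f \<Longrightarrow> integrable m (\<lambda>x. (norm (f x))\<^sup>2)"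
  by (rule integrable_bounded[where B="M\<^sup>2"]) (auto simp: bdd_by_def intro!: power_mono)

lemma bdd_by_diff: "bdd_by M f \<Longrightarrow> bdd_by M' g \<Longrightarrow> bdd_by (M + M') (\<lambda>x. f x - g x)"
  by (auto simp: bdd_by_def intro!: order_trans[OF norm_triangle_ineq4] add_mono)

lemma bdd_by_add: "bdd_by M f \<Longrightarrow> bdd_by M' g \<Longrightarrow> bdd_by (M + M') (\<lambda>x. f x + g x)"
  by (auto simp: bdd_by_def intro!: order_trans[OF norm_triangle_ineq] add_mono)

definition bohr_avg :: "('g \<Rightarrow> complex) \<Rightarrow> nat \<Rightarrow> ('x \<Rightarrow> complex) \<Rightarrow> 'x \<Rightarrow> complex" where
  "bohr_avg \<xi> n f x = (\<integral>t. cnj (\<xi> t) * f (act t x) \<partial>\<nu> n)"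

lemma bohr_avg_integrand:
  assumes "bdd_by M f" "\<xi> \<in> dual_group" "x \<in> space m"
  shows "(\<lambda>t. cnj (\<xi> t) * f (act t x)) \<in> borel_measurable borel" "norm (cnj (\<xi> t) * f (act t x)) \<le> M"
    and "integrable (\<nu> n) (\<lambda>t. cnj (\<xi> t) * f (act t x))"
proof -
  have [measurable]: "\<xi> \<in> borel_measurable borel" "f \<in> borel_measurable m"
    using assms by (auto simp: bdd_by_def dual_groupD)
  have [measurable]: "x \<in> space m" by fact
  show 1: "(\<lambda>t. cnj (\<xi> t) * f (act t x)) \<in> borel_measurable borel"
    by measurable
  show 2: "norm (cnj (\<xi> t) * f (act t x)) \<le> M" for t
    using assms by (auto simp: bdd_by_def dual_groupD norm_mult)
  show "integrable (\<nu> n) (\<lambda>t. cnj (\<xi> t) * f (act t x))"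
    using 1 2 by (intro \<nu>.integrable_bounded[where B=M]) auto
qed

lemma bdd_by_bohr_avg:
  assumes f: "bdd_by M f" and \<xi>: "\<xi> \<in> dual_group"
  shows "bdd_by M (bohr_avg \<xi> n f)"
proof -
  have [measurable]: "\<xi> \<in> borel_measurable borel" "f \<in> borel_measurable m"
    using assms by (auto simp: bdd_by_def dual_groupD)
  have "norm (bohr_avg \<xi> n f x) \<le> M" if "x \<in> space m" for x
    unfolding bohr_avg_def using bohr_avg_integrand[OF f \<xi> that] by (intro \<nu>.norm_integral_le_bound) auto
  moreover have "bohr_avg \<xi> n f \<in> borel_measurable m"
    unfolding bohr_avg_def by measurable
  ultimately show ?thesis unfolding bdd_by_def by simp
qed

lemma bohr_avg_diff:
  assumes "bdd_by M f" "bdd_by M' g" "\<xi> \<in> dual_group" "x \<in> space m"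
  shows "bohr_avg \<xi> n (\<lambda>x. f x - g x) x = bohr_avg \<xi> n f x - bohr_avg \<xi> n g x"
  using bohr_avg_integrand(3)[OF assms(1,3,4)] bohr_avg_integrand(3)[OF assms(2,3,4)]
  by (simp add: bohr_avg_def right_diff_distrib)

lemma bohr_avg_half_sum:
  assumes "bdd_by M f" "bdd_by M' g" "\<xi> \<in> dual_group" "x \<in> space m"
  shows "bohr_avg \<xi> n (\<lambda>x. (f x + g x) / 2) x = (bohr_avg \<xi> n f x + bohr_avg \<xi> n g x) / 2"
  using bohr_avg_integrand(3)[OF assms(1,3,4), of n] bohr_avg_integrand(3)[OF assms(2,3,4), of n]
  by (simp add: bohr_avg_def distrib_left)

text \<open>
  Applied to \<open>h u = cnj (\<xi> u) f (u.x)\<close>, the absorption estimate on the group becomes an estimate that is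
  uniform in \<open>x\<close> and in \<open>\<xi>\<close>, since \<open>cnj (\<xi> s) cnj (\<xi> t) f (t.(s.x)) = h (t + s)\<close>.
\<close>

lemma bohr_avg_bohr_avg:
  assumes f: "bdd_by M f" and \<xi>: "\<xi> \<in> dual_group" and x: "x \<in> space m"
  shows "norm (bohr_avg \<xi> n (bohr_avg \<xi> k f) x - bohr_avg \<xi> n f x) \<le> M * mean_defect n k"
proof -
  define h where "h u = cnj (\<xi> u) * f (act u x)" for u
  have h: "h \<in> borel_measurable borel" "\<And>t. norm (h t) \<le> M"
    using bohr_avg_integrand[OF f \<xi> x] by (auto simp: h_def[abs_def])
  have "bohr_avg \<xi> n (bohr_avg \<xi> k f) x = (\<integral>s. (\<integral>t. h (t + s) \<partial>\<nu> k) \<partial>\<nu> n)"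
  proof -
    have "h (t + s) = cnj (\<xi> s) * (cnj (\<xi> t) * f (act t (act s x)))" for s t
      using x by (simp add: h_def act_add dual_groupD(3)[OF \<xi>])
    then show ?thesis by (simp add: bohr_avg_def)
  qed
  moreover have "bohr_avg \<xi> n f x = (\<integral>s. h s \<partial>\<nu> n)"
    by (simp add: bohr_avg_def h_def)
  ultimately show ?thesis using average_average[OF h] by simp
qed

text \<open>
  The averages are almost equivariant, which will make their limit an eigenfunction.
\<close>

lemma bohr_avg_act:
  assumes f: "bdd_by M f" and \<xi>: "\<xi> \<in> dual_group" and x: "x \<in> space m"
  shows "norm (cnj (\<xi> t) * bohr_avg \<xi> n f (act t x) - bohr_avg \<xi> n f x) \<le> M * folner_defect n t"
proof -
  define h where "h u = cnj (\<xi> u) * f (act u x)" for u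
  have h: "h \<in> borel_measurable borel" "\<And>t. norm (h t) \<le> M"
    using bohr_avg_integrand[OF f \<xi> x] by (auto simp: h_def[abs_def])
  have "cnj (\<xi> t) * bohr_avg \<xi> n f (act t x) = (\<integral>s. h (t + s) \<partial>\<nu> n)"
  proof -
    have "h (t + s) = cnj (\<xi> t) * (cnj (\<xi> s) * f (act s (act t x)))" for s
      using x by (simp add: h_def add.commute[of t] act_add dual_groupD(3)[OF \<xi>])
    then show ?thesis by (simp add: bohr_avg_def)
  qed
  moreover have "bohr_avg \<xi> n f x = (\<integral>s. h s \<partial>\<nu> n)"
    by (simp add: bohr_avg_def h_def)
  ultimately show ?thesis using average_translate[OF h] by simp
qed

lemma integral_average:
  fixes f :: "'x \<Rightarrow> 'b::{banach, second_countable_topology}"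
  assumes [measurable]: "f \<in> borel_measurable m" and B: "\<And>x. x \<in> space m \<Longrightarrow> norm (f x) \<le> B"
  shows "(\<integral>x. (\<integral>t. f (act t x) \<partial>\<nu> n) \<partial>m) = (\<integral>x. f x \<partial>m)"
proof -
  have "(\<integral>x. (\<integral>t. f (act t x) \<partial>\<nu> n) \<partial>m) = (\<integral>t. (\<integral>x. f (act t x) \<partial>m) \<partial>\<nu> n)"
    using B by (intro Fubini_bounded[where B=B] prob_space_\<nu> prob_space_axioms) auto
  also have "\<dots> = (\<integral>x. f x \<partial>m)"
    by (simp add: integral_act \<nu>.prob_space[simplified])
  finally show ?thesis .
qed

lemma bohr_avg_square_le:
  assumes f: "bdd_by M f" and \<xi>: "\<xi> \<in> dual_group" and x: "x \<in> space m"
  shows "(norm (bohr_avg \<xi> n f x))\<^sup>2 \<le> (\<integral>t. (norm (f (act t x)))\<^sup>2 \<partial>\<nu> n)"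
proof -
  have "(norm (bohr_avg \<xi> n f x))\<^sup>2 \<le> (\<integral>t. (norm (cnj (\<xi> t) * f (act t x)))\<^sup>2 \<partial>\<nu> n)"
    unfolding bohr_avg_def using bohr_avg_integrand[OF f \<xi> x] by (intro \<nu>.norm_integral_square_le[where B=M]) auto
  then show ?thesis by (simp add: norm_mult dual_groupD(2)[OF \<xi>])
qed

lemma bohr_avg_contraction:
  assumes f: "bdd_by M f" and \<xi>: "\<xi> \<in> dual_group"
  shows "(\<integral>x. (norm (bohr_avg \<xi> n f x))\<^sup>2 \<partial>m) \<le> (\<integral>x. (norm (f x))\<^sup>2 \<partial>m)"
proof -
  have [measurable]: "f \<in> borel_measurable m" using f by (simp add: bdd_by_def)
  have b: "norm ((norm (f x))\<^sup>2) \<le> M\<^sup>2" if "x \<in> space m" for x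
    using bdd_byD(2)[OF f that] by (auto intro: power_mono)
  have "(\<integral>x. (norm (bohr_avg \<xi> n f x))\<^sup>2 \<partial>m) \<le> (\<integral>x. (\<integral>t. (norm (f (act t x)))\<^sup>2 \<partial>\<nu> n) \<partial>m)"
  proof (rule integral_mono)
    show "integrable m (\<lambda>x. (norm (bohr_avg \<xi> n f x))\<^sup>2)"
      by (rule bdd_by_integrable_square[OF bdd_by_bohr_avg[OF f \<xi>]])
    show "integrable m (\<lambda>x. \<integral>t. (norm (f (act t x)))\<^sup>2 \<partial>\<nu> n)"
      using b by (intro integrable_bounded[where B="M\<^sup>2"] \<nu>.norm_integral_le_bound) auto
  qed (rule bohr_avg_square_le[OF f \<xi>])
  also have "\<dots> = (\<integral>x. (norm (f x))\<^sup>2 \<partial>m)"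
    using b by (intro integral_average) auto
  finally show ?thesis .
qed

end

section \<open>The ergodic theorems for a fixed character\<close>

text \<open>
  The form in which the maximal inequality is used: a property that holds off sets of arbitrarily small
  measure holds almost everywhere.
\<close>

lemma AE_I_small:
  assumes "\<And>e::real. e > 0 \<Longrightarrow> \<exists>Z\<in>sets M. emeasure M Z \<le> ennreal e \<and> (AE x in M. x \<notin> Z \<longrightarrow> P x)"
  shows "AE x in M. P x"
proof -
  have "\<exists>Z\<in>sets M. emeasure M Z \<le> ennreal (1 / Suc j) \<and> (AE x in M. x \<notin> Z \<longrightarrow> P x)" for j
    by (intro assms) simp
  then obtain Z where Z: "\<And>j. Z j \<in> sets M" "\<And>j. emeasure M (Z j) \<le> ennreal (1 / Suc j)"
    "\<And>j. AE x in M. x \<notin> Z j \<longrightarrow> P x"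
    by metis
  have "emeasure M (\<Inter>j. Z j) \<le> 0"
  proof (rule LIMSEQ_le_const)
    show "(\<lambda>j. ennreal (1 / Suc j)) \<longlonglongrightarrow> 0"
      using tendsto_ennrealI[OF LIMSEQ_inverse_real_of_nat] by (simp add: inverse_eq_divide)
    have "emeasure M (\<Inter>j. Z j) \<le> ennreal (1 / Suc j)" for j
      using Z(1) by (intro order_trans[OF emeasure_mono Z(2)[of j]]) auto
    then show "\<exists>N. \<forall>n\<ge>N. emeasure M (\<Inter>j. Z j) \<le> ennreal (1 / Suc n)" by blast
  qed
  then have "(\<Inter>j. Z j) \<in> null_sets M"
    using Z(1) by (auto simp: null_sets_def)
  then have "AE x in M. x \<notin> (\<Inter>j. Z j)" by (rule AE_not_in)
  moreover have "AE x in M. \<forall>j. x \<notin> Z j \<longrightarrow> P x"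
    unfolding AE_all_countable using Z(3) by blast
  ultimately show ?thesis by eventually_elim auto
qed

context tempered_system begin

definition maximal_set :: "('x \<Rightarrow> complex) \<Rightarrow> real \<Rightarrow> 'x set" where
  "maximal_set u e = {x \<in> space m. \<exists>n. ennreal e < (\<integral>\<^sup>+t. ennreal (norm (u (act t x))) \<partial>\<nu> n)}"

lemma sets_maximal_set [measurable]:
  assumes [measurable]: "u \<in> borel_measurable m" shows "maximal_set u e \<in> sets m"
  unfolding maximal_set_def by measurable

lemma emeasure_maximal_set:
  assumes u: "integrable m u" and e: "e > 0"
  shows "emeasure m (maximal_set u e) \<le> ennreal (2 * (1 + C) * C * (\<integral>x. norm (u x) \<partial>m) / e)"
proof -
  have [measurable]: "u \<in> borel_measurable m" using u by simp
  have "ennreal e * emeasure m (maximal_set u e) \<le> ennreal (2 * (1 + C) * C) * (\<integral>\<^sup>+x. ennreal (norm (u x)) \<partial>m)"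
    unfolding maximal_set_def by (rule weak_maximal_inequality) measurable
  also have "\<dots> = ennreal (2 * (1 + C) * C * (\<integral>x. norm (u x) \<partial>m))"
    using u C_pos by (subst nn_integral_eq_integral) (auto simp: ennreal_mult)
  finally have *: "ennreal e * emeasure m (maximal_set u e) / ennreal e \<le> ennreal (2 * (1 + C) * C * (\<integral>x. norm (u x) \<partial>m)) / ennreal e"
    by (rule divide_right_mono_ennreal)
  moreover have "ennreal e * emeasure m (maximal_set u e) / ennreal e = emeasure m (maximal_set u e)"
    using e by (subst mult.commute, subst ennreal_mult_divide_eq) auto
  ultimately show ?thesis using e C_pos by (simp add: divide_ennreal)
qed

text \<open>
  The maximal set is defined by extended nonnegative integrals, so that off it the integrability of \<open>u\<close>
  along the orbit is part of the conclusion.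
\<close>

lemma not_maximal_setD:
  assumes [measurable]: "u \<in> borel_measurable m" and x: "x \<in> space m" "x \<notin> maximal_set u e" and e: "e \<ge> 0"
  shows "integrable (\<nu> n) (\<lambda>t. u (act t x))" "(\<integral>t. norm (u (act t x)) \<partial>\<nu> n) \<le> e"
proof -
  have [measurable]: "x \<in> space m" by fact
  have le: "(\<integral>\<^sup>+t. ennreal (norm (u (act t x))) \<partial>\<nu> n) \<le> ennreal e"
    using x by (auto simp: maximal_set_def not_less)
  show i: "integrable (\<nu> n) (\<lambda>t. u (act t x))"
  proof (rule integrableI_bounded)
    show "(\<integral>\<^sup>+t. ennreal (norm (u (act t x))) \<partial>\<nu> n) < \<infinity>"
      using le_less_trans[OF le] by simp
  qed measurable
  have "ennreal (\<integral>t. norm (u (act t x)) \<partial>\<nu> n) \<le> ennreal e"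
    using le i by (subst nn_integral_eq_integral[symmetric]) auto
  then show "(\<integral>t. norm (u (act t x)) \<partial>\<nu> n) \<le> e"
    using e by (simp add: ennreal_le_iff)
qed

text \<open>
  The proof of the von Neumann mean ergodic theorem by minimal norms, without a projection onto a closed
  subspace. Let \<open>K\<close> be the affine set of bounded functions with uniformly the same asymptotic averages
  as \<open>f\<close>, and \<open>a\<close> the infimum of the squared norm on \<open>K\<close>. The averages of \<open>f\<close> belong to \<open>K\<close>. Averaging is
  a contraction, so comparison with a nearly minimal element of \<open>K\<close> shows that their squared norms come
  down to \<open>a\<close>. Midpoints stay in \<open>K\<close>, hence cannot be shorter than \<open>a\<close>, and the parallelogram law
  finishes the argument.
\<close>

lemma bohr_avg_L2_Cauchy:
  assumes f: "bdd_by M f" and \<xi>: "\<xi> \<in> dual_group" and e: "e > (0::real)"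
  shows "\<exists>N. \<forall>i\<ge>N. \<forall>j\<ge>N. (\<integral>x. (norm (bohr_avg \<xi> i f x - bohr_avg \<xi> j f x))\<^sup>2 \<partial>m) < e"
proof -
  define q where "q g = (\<integral>x. (norm (g x))\<^sup>2 \<partial>m)" for g :: "'x \<Rightarrow> complex"
  define K where "K = {g. (\<exists>B. bdd_by B g) \<and>
     (\<forall>e>0. \<forall>\<^sub>F n in sequentially. \<forall>x\<in>space m. norm (bohr_avg \<xi> n g x - bohr_avg \<xi> n f x) \<le> e)}"
  have avg_in_K: "bohr_avg \<xi> k f \<in> K" for k
  proof -
    have "\<forall>\<^sub>F n in sequentially. \<forall>x\<in>space m. norm (bohr_avg \<xi> n (bohr_avg \<xi> k f) x - bohr_avg \<xi> n f x) \<le> r" if "r > 0" for r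
    proof -
      have "(\<lambda>n. M * mean_defect n k) \<longlonglongrightarrow> M * 0"
        by (intro tendsto_mult tendsto_const mean_defect_tendsto)
      then have "\<forall>\<^sub>F n in sequentially. M * mean_defect n k < r"
        using \<open>r > 0\<close> by (simp add: order_tendstoD)
      then show ?thesis
      proof eventually_elim
        case (elim n)
        then show ?case using bohr_avg_bohr_avg[OF f \<xi>, of _ n k] by (meson less_imp_le order_trans)
      qed
    qed
    then show ?thesis using bdd_by_bohr_avg[OF f \<xi>] by (auto simp: K_def)
  qed
  have mid_in_K: "(\<lambda>x. (g x + h x) / 2) \<in> K" if "g \<in> K" "h \<in> K" for g h
  proof -
    obtain B B' where B: "bdd_by B g" "bdd_by B' h"
      using \<open>g \<in> K\<close> \<open>h \<in> K\<close> unfolding K_def by blast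
    have "bdd_by (B + B') (\<lambda>x. (g x + h x) / 2)"
      using bdd_by_add[OF B] unfolding bdd_by_def by (auto simp: norm_divide) (smt (verit) norm_ge_zero)
    moreover have "\<forall>\<^sub>F n in sequentially. \<forall>x\<in>space m. norm (bohr_avg \<xi> n (\<lambda>x. (g x + h x) / 2) x - bohr_avg \<xi> n f x) \<le> r"
      if "r > 0" for r
    proof -
      have "\<forall>\<^sub>F n in sequentially. \<forall>x\<in>space m. norm (bohr_avg \<xi> n g x - bohr_avg \<xi> n f x) \<le> r"
        "\<forall>\<^sub>F n in sequentially. \<forall>x\<in>space m. norm (bohr_avg \<xi> n h x - bohr_avg \<xi> n f x) \<le> r"
        using \<open>g \<in> K\<close> \<open>h \<in> K\<close> that by (auto simp: K_def)
      then show ?thesis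
      proof eventually_elim
        case (elim n)
        show ?case
        proof
          fix x assume x: "x \<in> space m"
          have "bohr_avg \<xi> n (\<lambda>x. (g x + h x) / 2) x - bohr_avg \<xi> n f x
             = ((bohr_avg \<xi> n g x - bohr_avg \<xi> n f x) + (bohr_avg \<xi> n h x - bohr_avg \<xi> n f x)) / 2"
            by (simp add: bohr_avg_half_sum[OF B \<xi> x] field_simps)
          also have "norm \<dots> = norm ((bohr_avg \<xi> n g x - bohr_avg \<xi> n f x) + (bohr_avg \<xi> n h x - bohr_avg \<xi> n f x)) / 2"
            by (simp only: norm_divide norm_numeral)
          also have "\<dots> \<le> (norm (bohr_avg \<xi> n g x - bohr_avg \<xi> n f x) + norm (bohr_avg \<xi> n h x - bohr_avg \<xi> n f x)) / 2"
            by (intro divide_right_mono norm_triangle_ineq) simp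
          also have "\<dots> \<le> r"
            using bspec[OF elim(1) x] bspec[OF elim(2) x] by simp
          finally show "norm (bohr_avg \<xi> n (\<lambda>x. (g x + h x) / 2) x - bohr_avg \<xi> n f x) \<le> r" .
        qed
      qed
    qed
    ultimately show ?thesis unfolding K_def by blast
  qed
  define a where "a = (INF g\<in>K. q g)"
  have q_nonneg: "0 \<le> q g" for g unfolding q_def by simp
  have a_le: "a \<le> q g" if "g \<in> K" for g
    unfolding a_def using that q_nonneg by (intro cINF_lower bdd_belowI2[where m=0]) auto
  obtain g where g: "g \<in> K" "q g < a + e / 8"
  proof -
    have "a < a + e / 8" using e by simp
    then show ?thesis using avg_in_K that unfolding a_def
      by (subst (asm) cINF_less_iff) (auto intro!: bdd_belowI2[where m=0] q_nonneg)
  qed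
  obtain B where B: "bdd_by B g" using g(1) by (auto simp: K_def)
  have B0: "B \<ge> 0" by (rule bdd_by_nonneg[OF B])
  \<comment> \<open>Moving by at most \<open>r \<le> 1\<close> changes the square of a number bounded by \<open>B\<close> by at most \<open>r (2 B + 1)\<close>.\<close>
  define r where "r = min 1 (e / (16 * (2 * B + 1)))"
  have r: "r > 0" "r \<le> 1" "r * (2 * B + 1) \<le> e / 16"
  proof -
    show "r > 0" "r \<le> 1" using e B0 by (auto simp: r_def)
    have "r * (2 * B + 1) \<le> e / (16 * (2 * B + 1)) * (2 * B + 1)"
      using B0 by (intro mult_right_mono) (auto simp: r_def)
    moreover have "e / (16 * z) * z = e / 16" if "z > 0" for z :: real using that by simp
    from this[of "2 * B + 1"] have "e / (16 * (2 * B + 1)) * (2 * B + 1) = e / 16"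
      using B0 by linarith
    ultimately show "r * (2 * B + 1) \<le> e / 16" by linarith
  qed
  have "\<forall>\<^sub>F n in sequentially. \<forall>x\<in>space m. norm (bohr_avg \<xi> n g x - bohr_avg \<xi> n f x) \<le> r"
    using g(1) r(1) by (auto simp: K_def)
  then obtain N where N: "\<And>n x. n \<ge> N \<Longrightarrow> x \<in> space m \<Longrightarrow> norm (bohr_avg \<xi> n g x - bohr_avg \<xi> n f x) \<le> r"
    by (auto simp: eventually_sequentially)
  have q_tw: "q (bohr_avg \<xi> n f) < a + e / 4" if "n \<ge> N" for n
  proof -
    have "q (bohr_avg \<xi> n f) \<le> (\<integral>x. (norm (bohr_avg \<xi> n g x))\<^sup>2 + r * (2 * B + 1) \<partial>m)"
      unfolding q_def
    proof (rule integral_mono)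
      show "integrable m (\<lambda>x. (norm (bohr_avg \<xi> n f x))\<^sup>2)"
        by (rule bdd_by_integrable_square[OF bdd_by_bohr_avg[OF f \<xi>]])
      show "integrable m (\<lambda>x. (norm (bohr_avg \<xi> n g x))\<^sup>2 + r * (2 * B + 1))"
        using bdd_by_integrable_square[OF bdd_by_bohr_avg[OF B \<xi>]] by simp
      fix x assume x: "x \<in> space m"
      have "norm (bohr_avg \<xi> n f x) \<le> norm (bohr_avg \<xi> n g x) + r"
        using N[OF that x] norm_triangle_sub[of "bohr_avg \<xi> n f x" "bohr_avg \<xi> n g x"] by (simp add: norm_minus_commute)
      then have "(norm (bohr_avg \<xi> n f x))\<^sup>2 \<le> (norm (bohr_avg \<xi> n g x) + r)\<^sup>2"
        by (intro power_mono) auto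
      also have "\<dots> = (norm (bohr_avg \<xi> n g x))\<^sup>2 + r * (2 * norm (bohr_avg \<xi> n g x) + r)"
        by (simp add: power2_eq_square algebra_simps)
      also have "\<dots> \<le> (norm (bohr_avg \<xi> n g x))\<^sup>2 + r * (2 * B + 1)"
        using r bdd_byD(2)[OF bdd_by_bohr_avg[OF B \<xi>] x, of n] by (intro add_left_mono mult_left_mono) auto
      finally show "(norm (bohr_avg \<xi> n f x))\<^sup>2 \<le> (norm (bohr_avg \<xi> n g x))\<^sup>2 + r * (2 * B + 1)" .
    qed
    also have "\<dots> = q (bohr_avg \<xi> n g) + r * (2 * B + 1)"
      using bdd_by_integrable_square[OF bdd_by_bohr_avg[OF B \<xi>]] by (simp add: q_def prob_space)
    also have "q (bohr_avg \<xi> n g) \<le> q g"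
      unfolding q_def by (rule bohr_avg_contraction[OF B \<xi>])
    finally show ?thesis using g(2) r(3) e by simp
  qed
  have "q (\<lambda>x. bohr_avg \<xi> i f x - bohr_avg \<xi> j f x) < e" if ij: "i \<ge> N" "j \<ge> N" for i j
  proof -
    define u v where "u = bohr_avg \<xi> i f" and "v = bohr_avg \<xi> j f"
    have b: "bdd_by M u" "bdd_by M v" unfolding u_def v_def by (rule bdd_by_bohr_avg[OF f \<xi>])+
    have i1: "integrable m (\<lambda>x. (norm (u x))\<^sup>2)" "integrable m (\<lambda>x. (norm (v x))\<^sup>2)"
      "integrable m (\<lambda>x. (norm ((u x + v x) / 2))\<^sup>2)"
      using b bdd_by_integrable_square[OF bdd_by_add[OF b]]
      by (auto intro: bdd_by_integrable_square simp: norm_divide power_divide)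
    have "(norm (u x - v x))\<^sup>2 = 2 * (norm (u x))\<^sup>2 + 2 * (norm (v x))\<^sup>2 - 4 * (norm ((u x + v x) / 2))\<^sup>2" for x
      unfolding cmod_power2 by (simp add: power2_eq_square field_simps)
    then have "q (\<lambda>x. u x - v x) = 2 * q u + 2 * q v - 4 * q (\<lambda>x. (u x + v x) / 2)"
      using i1 unfolding q_def by simp
    moreover have "a \<le> q (\<lambda>x. (u x + v x) / 2)"
      unfolding u_def v_def by (intro a_le mid_in_K avg_in_K)
    ultimately show ?thesis using q_tw[OF ij(1)] q_tw[OF ij(2)] unfolding u_def v_def by simp
  qed
  then show ?thesis unfolding q_def by blast
qed

lemma L1_le_L2:
  assumes "bdd_by M f" shows "(\<integral>x. norm (f x) \<partial>m)\<^sup>2 \<le> (\<integral>x. (norm (f x))\<^sup>2 \<partial>m)"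
  using norm_integral_square_le[of "\<lambda>x. norm (f x)" M] assms by (auto simp: bdd_by_def)

text \<open>
  Convergence in \<open>L\<^sup>1\<close> is all that is needed later, and for functions bounded by \<open>M\<close> it is equivalent to
  convergence in \<open>L\<^sup>2\<close>. The limit is constructed as a pointwise limit along a subsequence; equivariance
  survives in the limit by \<open>bohr_avg_act\<close>.
\<close>

theorem mean_ergodic:
  assumes f: "bdd_by M f" and \<xi>: "\<xi> \<in> dual_group"
  obtains g where "bdd_by M g" "(\<lambda>n. \<integral>x. norm (bohr_avg \<xi> n f x - g x) \<partial>m) \<longlonglongrightarrow> 0"
    "\<And>t. AE x in m. g (act t x) = \<xi> t * g x"
proof -
  have M0: "M \<ge> 0" by (rule bdd_by_nonneg[OF f])
  note bt = bdd_by_bohr_avg[OF f \<xi>]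
  have cauchy: "\<exists>N. \<forall>i\<ge>N. \<forall>j\<ge>N. (\<integral>x. norm (bohr_avg \<xi> i f x - bohr_avg \<xi> j f x) \<partial>m) < e" if e: "e > 0" for e
  proof -
    obtain N where N: "\<forall>i\<ge>N. \<forall>j\<ge>N. (\<integral>x. (norm (bohr_avg \<xi> i f x - bohr_avg \<xi> j f x))\<^sup>2 \<partial>m) < e\<^sup>2"
      using bohr_avg_L2_Cauchy[OF f \<xi>, of "e\<^sup>2"] e by auto
    have "(\<integral>x. norm (bohr_avg \<xi> i f x - bohr_avg \<xi> j f x) \<partial>m) < e" if "i \<ge> N" "j \<ge> N" for i j
    proof (rule power_less_imp_less_base)
      show "(\<integral>x. norm (bohr_avg \<xi> i f x - bohr_avg \<xi> j f x) \<partial>m)\<^sup>2 < e\<^sup>2"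
        using L1_le_L2[OF bdd_by_diff[OF bt bt], of i j] N that by (meson le_less_trans)
    qed (use e in simp)
    then show ?thesis by blast
  qed
  obtain r where r: "strict_mono r" "AE x in m. Cauchy (\<lambda>i. bohr_avg \<xi> (r i) f x)"
    using cauchy_L1_AE_cauchy_subseq[of m "\<lambda>n. bohr_avg \<xi> n f"] cauchy bdd_by_integrable[OF bt] by blast
  define l where "l x = lim (\<lambda>i. bohr_avg \<xi> (r i) f x)" for x
  \<comment> \<open>Where the subsequence diverges, \<open>l\<close> is an unspecified value; the cutoff keeps \<open>g\<close> bounded everywhere.\<close>
  define g where "g x = (if norm (l x) \<le> M then l x else 0)" for x
  have [measurable]: "bohr_avg \<xi> n f \<in> borel_measurable m" for n
    using bt by (simp add: bdd_by_def)
  have [measurable]: "l \<in> borel_measurable m"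
    unfolding l_def by measurable
  have g: "bdd_by M g"
    unfolding bdd_by_def g_def using M0 by auto
  have [measurable]: "g \<in> borel_measurable m" using g by (simp add: bdd_by_def)
  have lim: "AE x in m. (\<lambda>i. bohr_avg \<xi> (r i) f x) \<longlonglongrightarrow> g x"
    using r(2) AE_space
  proof eventually_elim
    case (elim x)
    have 1: "(\<lambda>i. bohr_avg \<xi> (r i) f x) \<longlonglongrightarrow> l x"
      using elim unfolding l_def by (simp add: Cauchy_convergent convergent_LIMSEQ_iff[symmetric])
    have "norm (l x) \<le> M"
      by (rule LIMSEQ_le_const2[OF tendsto_norm[OF 1]]) (use bdd_byD(2)[OF bt elim(2)] in blast)
    then show ?case using 1 by (simp add: g_def)
  qed
  have "(\<lambda>i. \<integral>x. norm (bohr_avg \<xi> (r i) f x - g x) \<partial>m) \<longlonglongrightarrow> (\<integral>x. 0 \<partial>m)"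
  proof (rule integral_dominated_convergence[where w="\<lambda>_. M + M"])
    show "AE x in m. (\<lambda>i. norm (bohr_avg \<xi> (r i) f x - g x)) \<longlonglongrightarrow> 0"
      using lim by eventually_elim (simp add: tendsto_norm_zero_iff LIM_zero_iff)
    show "AE x in m. norm (norm (bohr_avg \<xi> (r i) f x - g x)) \<le> M + M" for i
      using bdd_byD(2)[OF bdd_by_diff[OF bt g]] by auto
  qed simp_all
  then have sub: "(\<lambda>i. \<integral>x. norm (bohr_avg \<xi> (r i) f x - g x) \<partial>m) \<longlonglongrightarrow> 0" by simp
  have tri: "(\<integral>x. norm (u x - w x) \<partial>m) \<le> (\<integral>x. norm (u x - v x) \<partial>m) + (\<integral>x. norm (v x - w x) \<partial>m)"
    if b: "bdd_by B1 u" "bdd_by B2 v" "bdd_by B3 w" for u v w B1 B2 B3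
  proof -
    have i: "integrable m (\<lambda>x. norm (u x - v x))" "integrable m (\<lambda>x. norm (v x - w x))"
      "integrable m (\<lambda>x. norm (u x - w x))"
      using b by (auto intro!: integrable_norm bdd_by_integrable bdd_by_diff)
    have "(\<integral>x. norm (u x - w x) \<partial>m) \<le> (\<integral>x. norm (u x - v x) + norm (v x - w x) \<partial>m)"
    proof (intro integral_mono Bochner_Integration.integrable_add i)
      show "norm (u x - w x) \<le> norm (u x - v x) + norm (v x - w x)" for x
        using norm_triangle_ineq[of "u x - v x" "v x - w x"] by simp
    qed
    then show ?thesis using i by simp
  qed
  have conv: "(\<lambda>n. \<integral>x. norm (bohr_avg \<xi> n f x - g x) \<partial>m) \<longlonglongrightarrow> 0"
  proof (rule LIMSEQ_I)
    fix e :: real assume e: "e > 0"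
    obtain N where N: "\<And>i j. i \<ge> N \<Longrightarrow> j \<ge> N \<Longrightarrow> (\<integral>x. norm (bohr_avg \<xi> i f x - bohr_avg \<xi> j f x) \<partial>m) < e / 2"
      using cauchy[of "e / 2"] e by auto
    have "\<forall>\<^sub>F i in sequentially. (\<integral>x. norm (bohr_avg \<xi> (r i) f x - g x) \<partial>m) < e / 2"
      using order_tendstoD(2)[OF sub, of "e / 2"] e by simp
    then obtain k where k: "k \<ge> N" "(\<integral>x. norm (bohr_avg \<xi> (r k) f x - g x) \<partial>m) < e / 2"
      unfolding eventually_sequentially by (meson le_cases order_refl order_trans)
    have rk: "r k \<ge> N" using k(1) seq_suble[OF r(1), of k] by linarith
    have "(\<integral>x. norm (bohr_avg \<xi> n f x - g x) \<partial>m) < e" if "n \<ge> N" for n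
      using tri[OF bt bt g, of n "r k"] N[OF that rk] k(2) by simp
    then show "\<exists>no. \<forall>n\<ge>no. norm ((\<integral>x. norm (bohr_avg \<xi> n f x - g x) \<partial>m) - 0) < e"
      by auto
  qed
  moreover have "AE x in m. g (act t x) = \<xi> t * g x" for t
  proof -
    have n1: "norm (cnj (\<xi> t)) = 1" using dual_groupD(2)[OF \<xi>] by simp
    define G where "G x = cnj (\<xi> t) * g (act t x)" for x
    have G: "bdd_by M G" using g n1 unfolding bdd_by_def G_def by (auto simp: norm_mult)
    have "(\<integral>x. norm (G x - g x) \<partial>m) \<le> 2 * (\<integral>x. norm (bohr_avg \<xi> n f x - g x) \<partial>m) + M * folner_defect n t" for n
    proof -
      define T where "T x = cnj (\<xi> t) * bohr_avg \<xi> n f (act t x)" for x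
      have T: "bdd_by M T" using bt[of n] n1 unfolding bdd_by_def T_def by (auto simp: norm_mult)
      have "(\<integral>x. norm (G x - g x) \<partial>m) \<le> (\<integral>x. norm (G x - T x) \<partial>m) + (\<integral>x. norm (T x - g x) \<partial>m)"
        by (rule tri[OF G T g])
      also have "(\<integral>x. norm (T x - g x) \<partial>m) \<le> (\<integral>x. norm (T x - bohr_avg \<xi> n f x) \<partial>m) + (\<integral>x. norm (bohr_avg \<xi> n f x - g x) \<partial>m)"
        by (rule tri[OF T bt g])
      also have "(\<integral>x. norm (T x - bohr_avg \<xi> n f x) \<partial>m) \<le> (\<integral>x. M * folner_defect n t \<partial>m)"
        using bohr_avg_act[OF f \<xi>, of _ t n] bdd_by_integrable[OF bdd_by_diff[OF T bt], of n]
        by (intro integral_mono integrable_norm) (auto simp: T_def)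
      also have "(\<integral>x. norm (G x - T x) \<partial>m) = (\<integral>x. norm (bohr_avg \<xi> n f (act t x) - g (act t x)) \<partial>m)"
        unfolding G_def T_def right_diff_distrib[symmetric]
        by (simp add: norm_mult dual_groupD(2)[OF \<xi>] norm_minus_commute)
      also have "\<dots> = (\<integral>x. norm (bohr_avg \<xi> n f x - g x) \<partial>m)"
        by (rule integral_act[of "\<lambda>x. norm (bohr_avg \<xi> n f x - g x)"]) measurable
      finally show ?thesis by (simp add: prob_space)
    qed
    moreover have "(\<lambda>n. 2 * (\<integral>x. norm (bohr_avg \<xi> n f x - g x) \<partial>m) + M * folner_defect n t) \<longlonglongrightarrow> 2 * 0 + M * 0"
      by (intro tendsto_intros conv folner_defect_tendsto)
    ultimately have "(\<integral>x. norm (G x - g x) \<partial>m) \<le> 0"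
      by (intro LIMSEQ_le_const[where X="\<lambda>n. 2 * (\<integral>x. norm (bohr_avg \<xi> n f x - g x) \<partial>m) + M * folner_defect n t"]) auto
    then have "(\<integral>x. norm (G x - g x) \<partial>m) = 0"
      by (intro antisym) auto
    then have "AE x in m. norm (G x - g x) = 0"
      by (subst (asm) integral_nonneg_eq_0_iff_AE) (auto intro!: integrable_norm bdd_by_integrable[OF bdd_by_diff[OF G g]])
    then show ?thesis
    proof eventually_elim
      case (elim x)
      have "g (act t x) = \<xi> t * (cnj (\<xi> t) * g (act t x))"
        by (simp add: dual_groupD(4)[OF \<xi>] mult.assoc[symmetric])
      also have "cnj (\<xi> t) * g (act t x) = g x" using elim by (simp add: G_def)
      finally show ?case .
    qed
  qed
  ultimately show ?thesis using g that by blast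
qed

text \<open>
  Equivariance holds for each \<open>t\<close> off a null set depending on \<open>t\<close>; Fubini turns this into almost every
  point of almost every orbit, which is what an average sees.
\<close>

lemma invariant_average:
  assumes g: "bdd_by M g" and \<xi>: "\<xi> \<in> dual_group" and inv: "\<And>t. AE x in m. g (act t x) = \<xi> t * g x"
  shows "AE x in m. \<forall>n. bohr_avg \<xi> n g x = g x"
proof -
  have [measurable]: "g \<in> borel_measurable m" "\<xi> \<in> borel_measurable borel"
    using g \<xi> by (simp_all add: bdd_by_def dual_groupD)
  have "{p \<in> space (m \<Otimes>\<^sub>M \<mu>). g (act (snd p) (fst p)) = \<xi> (snd p) * g (fst p)}
      = {p \<in> space (m \<Otimes>\<^sub>M \<mu>). norm (g (act (snd p) (fst p)) - \<xi> (snd p) * g (fst p)) = 0}"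
    by auto
  also have "\<dots> \<in> sets (m \<Otimes>\<^sub>M \<mu>)" by measurable
  finally have "AE x in m. AE t in \<mu>. g (act t x) = \<xi> t * g x"
    using inv by (subst sys.AE_commute) simp_all
  then show ?thesis using AE_space
  proof eventually_elim
    case (elim x)
    have [measurable]: "x \<in> space m" by fact
    show ?case
    proof
      fix n
      have "AE t in \<nu> n. g (act t x) = \<xi> t * g x"
        unfolding \<nu>_def using elim(1) by (intro AE_uniform_measureI) auto
      then have "bohr_avg \<xi> n g x = (\<integral>t. cnj (\<xi> t) * (\<xi> t * g x) \<partial>\<nu> n)"
        unfolding bohr_avg_def by (intro integral_cong_AE) auto
      also have "\<dots> = (\<integral>t. g x \<partial>\<nu> n)"
        using dual_groupD(4)[OF \<xi>] by (intro Bochner_Integration.integral_cong refl) (metis mult.assoc mult.commute mult_1)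
      also have "\<dots> = g x" by (simp add: \<nu>.prob_space[simplified])
      finally show "bohr_avg \<xi> n g x = g x" .
    qed
  qed
qed

text \<open>
  With \<open>u = A\<^sub>k f - g\<close> the difference \<open>A\<^sub>n f - g\<close> equals \<open>A\<^sub>n u\<close> up to an error that tends to 0, because
  averaging fixes \<open>g\<close>. The maximal inequality makes all \<open>A\<^sub>n u\<close> small off a set whose measure is of the
  order of \<open>\<integral> |u|\<close>, and this is small for large \<open>k\<close>.
\<close>

theorem pointwise_ergodic:
  assumes f: "bdd_by M f" and \<xi>: "\<xi> \<in> dual_group"
  obtains g where "bdd_by M g" "AE x in m. (\<lambda>n. bohr_avg \<xi> n f x) \<longlonglongrightarrow> g x"
    "(\<lambda>n. \<integral>x. norm (bohr_avg \<xi> n f x - g x) \<partial>m) \<longlonglongrightarrow> 0"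
    "\<And>t. AE x in m. g (act t x) = \<xi> t * g x"
proof -
  obtain g where g: "bdd_by M g" and conv: "(\<lambda>n. \<integral>x. norm (bohr_avg \<xi> n f x - g x) \<partial>m) \<longlonglongrightarrow> 0"
    and inv: "\<And>t. AE x in m. g (act t x) = \<xi> t * g x"
    using mean_ergodic[OF f \<xi>] by blast
  note bt = bdd_by_bohr_avg[OF f \<xi>]
  have [measurable]: "g \<in> borel_measurable m" "bohr_avg \<xi> n f \<in> borel_measurable m" for n
    using g bt by (simp_all add: bdd_by_def)
  have ev: "AE x in m. \<forall>\<^sub>F n in sequentially. norm (bohr_avg \<xi> n f x - g x) < e" if e: "e > 0" for e
  proof (rule AE_I_small)
    fix r :: real assume r: "r > 0"
    define K where "K = 2 * (1 + C) * C"
    have "(\<lambda>k. K * (\<integral>x. norm (bohr_avg \<xi> k f x - g x) \<partial>m) / (e / 2)) \<longlonglongrightarrow> K * 0 / (e / 2)"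
      using e by (intro tendsto_intros conv) auto
    then have "\<forall>\<^sub>F k in sequentially. K * (\<integral>x. norm (bohr_avg \<xi> k f x - g x) \<partial>m) / (e / 2) < r"
      using r by (simp add: order_tendstoD)
    then obtain k where k: "K * (\<integral>x. norm (bohr_avg \<xi> k f x - g x) \<partial>m) / (e / 2) < r"
      by (auto simp: eventually_sequentially)
    define u where "u x = bohr_avg \<xi> k f x - g x" for x
    have bu: "bdd_by (M + M) u" unfolding u_def by (rule bdd_by_diff[OF bt g])
    have [measurable]: "u \<in> borel_measurable m" using bu by (simp add: bdd_by_def)
    define Z where "Z = maximal_set u (e / 2)"
    have "emeasure m Z \<le> ennreal (K * (\<integral>x. norm (u x) \<partial>m) / (e / 2))"
      unfolding Z_def K_def using e by (intro emeasure_maximal_set bdd_by_integrable[OF bu]) simp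
    also have "\<dots> \<le> ennreal r"
      using k by (intro ennreal_leI) (simp add: u_def)
    finally have Z: "emeasure m Z \<le> ennreal r" .
    have "AE x in m. x \<notin> Z \<longrightarrow> (\<forall>\<^sub>F n in sequentially. norm (bohr_avg \<xi> n f x - g x) < e)"
      using invariant_average[OF g \<xi> inv] AE_space
    proof (eventually_elim, intro impI)
      fix x assume gx: "\<forall>n. bohr_avg \<xi> n g x = g x" and x: "x \<in> space m" and xZ: "x \<notin> Z"
      have le: "norm (bohr_avg \<xi> n f x - g x) \<le> M * mean_defect n k + e / 2" for n
      proof -
        have "bohr_avg \<xi> n u x = bohr_avg \<xi> n (bohr_avg \<xi> k f) x - g x"
          using bohr_avg_diff[OF bt g \<xi> x, of n k] gx by (simp add: u_def[abs_def])
        then have "bohr_avg \<xi> n f x - g x = bohr_avg \<xi> n u x - (bohr_avg \<xi> n (bohr_avg \<xi> k f) x - bohr_avg \<xi> n f x)" by simp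
        also have "norm \<dots> \<le> norm (bohr_avg \<xi> n u x) + norm (bohr_avg \<xi> n (bohr_avg \<xi> k f) x - bohr_avg \<xi> n f x)"
          by (rule norm_triangle_ineq4)
        also have "norm (bohr_avg \<xi> n u x) \<le> (\<integral>t. norm (cnj (\<xi> t) * u (act t x)) \<partial>\<nu> n)"
          unfolding bohr_avg_def by simp
        also have "\<dots> = (\<integral>t. norm (u (act t x)) \<partial>\<nu> n)"
          by (simp add: norm_mult dual_groupD(2)[OF \<xi>])
        also have "\<dots> \<le> e / 2"
          using xZ e unfolding Z_def by (intro not_maximal_setD x) auto
        also have "norm (bohr_avg \<xi> n (bohr_avg \<xi> k f) x - bohr_avg \<xi> n f x) \<le> M * mean_defect n k"
          by (rule bohr_avg_bohr_avg[OF f \<xi> x])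
        finally show ?thesis by simp
      qed
      have "(\<lambda>n. M * mean_defect n k + e / 2) \<longlonglongrightarrow> M * 0 + e / 2"
        by (intro tendsto_intros mean_defect_tendsto)
      then have "\<forall>\<^sub>F n in sequentially. M * mean_defect n k + e / 2 < e"
        using e by (simp add: order_tendstoD)
      then show "\<forall>\<^sub>F n in sequentially. norm (bohr_avg \<xi> n f x - g x) < e"
        by eventually_elim (rule le_less_trans[OF le])
    qed
    then show "\<exists>Z\<in>sets m. emeasure m Z \<le> ennreal r \<and>
        (AE x in m. x \<notin> Z \<longrightarrow> (\<forall>\<^sub>F n in sequentially. norm (bohr_avg \<xi> n f x - g x) < e))"
      using Z by (intro bexI[of _ Z]) (auto simp: Z_def)
  qed
  have "AE x in m. \<forall>j. \<forall>\<^sub>F n in sequentially. norm (bohr_avg \<xi> n f x - g x) < 1 / Suc j"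
    unfolding AE_all_countable by (intro allI ev) simp
  then have "AE x in m. (\<lambda>n. bohr_avg \<xi> n f x) \<longlonglongrightarrow> g x"
  proof eventually_elim
    case (elim x)
    show ?case
    proof (rule tendstoI)
      fix e :: real assume "e > 0"
      then obtain j where j: "1 / Suc j < e" using nat_approx_posE by blast
      show "\<forall>\<^sub>F n in sequentially. dist (bohr_avg \<xi> n f x) (g x) < e"
        using elim[rule_format, of j] by eventually_elim (use j in \<open>simp add: dist_norm\<close>)
    qed
  qed
  then show ?thesis using that g conv inv by blast
qed

end

section \<open>All characters outside the eigenvalues at once\<close>

text \<open>
  Countably many quantifiers suffice to express convergence, which makes sets of convergence measurable.
\<close>

lemma LIMSEQ_iff_reciprocal:
  fixes X :: "nat \<Rightarrow> 'a::metric_space"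
  shows "X \<longlonglongrightarrow> L \<longleftrightarrow> (\<forall>j. \<exists>N. \<forall>n\<ge>N. dist (X n) L < 1 / Suc j)"
proof
  assume "X \<longlonglongrightarrow> L"
  then show "\<forall>j. \<exists>N. \<forall>n\<ge>N. dist (X n) L < 1 / Suc j"
    by (intro allI metric_LIMSEQ_D) simp_all
next
  assume *: "\<forall>j. \<exists>N. \<forall>n\<ge>N. dist (X n) L < 1 / Suc j"
  show "X \<longlonglongrightarrow> L"
  proof (rule metric_LIMSEQ_I)
    fix e :: real assume "e > 0"
    then obtain j where "1 / Suc j < e" using nat_approx_posE by blast
    then show "\<exists>N. \<forall>n\<ge>N. dist (X n) L < e" using * by (meson less_trans)
  qed
qed

lemma sets_Collect_tendsto:
  fixes F :: "nat \<Rightarrow> 'a \<Rightarrow> complex"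
  assumes [measurable]: "\<And>n. F n \<in> borel_measurable M" "G \<in> borel_measurable M"
  shows "{x \<in> space M. (\<lambda>n. F n x) \<longlonglongrightarrow> G x} \<in> sets M"
  unfolding LIMSEQ_iff_reciprocal by measurable

text \<open>
  Used twice: for truncations of an integrable function, and for uniform limits of elements of the span
  of the core.
\<close>

lemma uniformly_approximated_limits:
  fixes X :: "nat \<Rightarrow> 'a::banach"
  assumes "\<And>e. e > 0 \<Longrightarrow> \<exists>Y. (\<forall>n. norm (X n - Y n) \<le> e) \<and> P Y"
  shows "(\<And>Y. P Y \<Longrightarrow> convergent Y) \<Longrightarrow> convergent X"
    and "(\<And>Y. P Y \<Longrightarrow> Y \<longlonglongrightarrow> 0) \<Longrightarrow> X \<longlonglongrightarrow> 0"
proof -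
  show "convergent X" if P: "\<And>Y. P Y \<Longrightarrow> convergent Y"
  proof (rule Cauchy_convergent, rule CauchyI)
    fix e :: real assume e: "e > 0"
    obtain Y where Y: "\<And>n. norm (X n - Y n) \<le> e / 4" "P Y"
      using assms[of "e / 4"] e by auto
    obtain N where N: "\<And>i j. i \<ge> N \<Longrightarrow> j \<ge> N \<Longrightarrow> norm (Y i - Y j) < e / 4"
      using CauchyD[OF convergent_Cauchy[OF P[OF Y(2)]], of "e / 4"] e by auto
    have "norm (X i - X j) < e" if "i \<ge> N" "j \<ge> N" for i j
    proof -
      have "X i - X j = (X i - Y i) + (Y i - Y j) - (X j - Y j)" by simp
      also have "norm \<dots> \<le> norm (X i - Y i) + norm (Y i - Y j) + norm (X j - Y j)"
        by (intro norm_triangle_le_diff add_mono norm_triangle_ineq order_refl)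
      also have "\<dots> < e" using Y(1)[of i] Y(1)[of j] N[OF that] e by linarith
      finally show ?thesis .
    qed
    then show "\<exists>N. \<forall>i\<ge>N. \<forall>j\<ge>N. norm (X i - X j) < e" by blast
  qed
  show "X \<longlonglongrightarrow> 0" if P: "\<And>Y. P Y \<Longrightarrow> Y \<longlonglongrightarrow> 0"
  proof (rule LIMSEQ_I)
    fix e :: real assume e: "e > 0"
    obtain Y where Y: "\<And>n. norm (X n - Y n) \<le> e / 4" "P Y"
      using assms[of "e / 4"] e by auto
    obtain N where N: "\<And>i. i \<ge> N \<Longrightarrow> norm (Y i) < e / 4"
      using LIMSEQ_D[OF P[OF Y(2)], of "e / 4"] e by auto
    have "norm (X i - 0) < e" if "i \<ge> N" for i
      using norm_triangle_ineq[of "X i - Y i" "Y i"] Y(1)[of i] N[OF that] e by simp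
    then show "\<exists>N. \<forall>i\<ge>N. norm (X i - 0) < e" by blast
  qed
qed

context tempered_system begin

lemma one_in_dual: "(\<lambda>_. 1) \<in> (dual_group :: ('g \<Rightarrow> complex) set)"
  by (simp add: dual_group_def)

theorem ergodic_average:
  assumes erg: "ergodic act m" and f: "bdd_by M f"
  shows "AE x in m. (\<lambda>n. \<integral>t. f (act t x) \<partial>\<nu> n) \<longlonglongrightarrow> (\<integral>x. f x \<partial>m)"
proof -
  let ?avg = "bohr_avg (\<lambda>_. 1)"
  have tw1: "?avg n f x = (\<integral>t. f (act t x) \<partial>\<nu> n)" for n x
    by (simp add: bohr_avg_def)
  obtain g where g: "bdd_by M g" "AE x in m. (\<lambda>n. ?avg n f x) \<longlonglongrightarrow> g x"
    "(\<lambda>n. \<integral>x. norm (?avg n f x - g x) \<partial>m) \<longlonglongrightarrow> 0" "\<And>t. AE x in m. g (act t x) = 1 * g x"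
    using pointwise_ergodic[OF f one_in_dual] by blast
  have [measurable]: "f \<in> borel_measurable m" "g \<in> borel_measurable m"
    using f g(1) by (simp_all add: bdd_by_def)
  obtain c where c: "AE x in m. g x = c"
    using erg[unfolded ergodic_def, rule_format, of g] g(4) by auto
  have "norm ((\<integral>x. f x \<partial>m) - c) \<le> (\<integral>x. norm (?avg n f x - g x) \<partial>m)" for n
  proof -
    have "(\<integral>x. ?avg n f x \<partial>m) = (\<integral>x. f x \<partial>m)"
      unfolding tw1 using bdd_byD(2)[OF f] by (intro integral_average) auto
    moreover have "(\<integral>x. g x \<partial>m) = (\<integral>x. c \<partial>m)"
      using c by (intro integral_cong_AE) auto
    ultimately have "(\<integral>x. f x \<partial>m) - c = (\<integral>x. ?avg n f x - g x \<partial>m)"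
      using bdd_by_integrable[OF bdd_by_bohr_avg[OF f one_in_dual]] bdd_by_integrable[OF g(1)]
      by (simp add: prob_space)
    then show ?thesis by simp
  qed
  then have "norm ((\<integral>x. f x \<partial>m) - c) \<le> 0"
    using g(3) by (intro LIMSEQ_le_const[where X="\<lambda>n. \<integral>x. norm (?avg n f x - g x) \<partial>m"]) auto
  then have c_eq: "c = (\<integral>x. f x \<partial>m)" by simp
  show ?thesis using g(2) c unfolding tw1 by eventually_elim (simp add: c_eq)
qed

text \<open>
  Stated for a general probability space mapped into the phase space, because it is used for the phase
  space itself and for the orbit of a point over \<open>A n\<close>. On the right-hand side the inner integral does
  not involve \<open>\<xi>\<close>.
\<close>

lemma bohr_avg_square_as_correlations:
  assumes P: "prob_space P" and \<phi> [measurable]: "\<phi> \<in> measurable P m"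
    and f: "bdd_by M f" and \<xi>: "\<xi> \<in> dual_group"
  shows "complex_of_real (\<integral>p. (norm (bohr_avg \<xi> k f (\<phi> p)))\<^sup>2 \<partial>P)
    = (\<integral>q. cnj (\<xi> (fst q)) * \<xi> (snd q) * (\<integral>p. f (act (fst q) (\<phi> p)) * cnj (f (act (snd q) (\<phi> p))) \<partial>P) \<partial>(\<nu> k \<Otimes>\<^sub>M \<nu> k))"
proof -
  interpret P: prob_space P by fact
  interpret kk: pair_prob_space "\<nu> k" "\<nu> k" ..
  have [measurable]: "f \<in> borel_measurable m" "\<xi> \<in> borel_measurable borel"
    using f \<xi> by (simp_all add: bdd_by_def dual_groupD)
  define F where "F y s = cnj (\<xi> s) * f (act s y)" for y s
  have F_le: "norm (F y s) \<le> M" if "y \<in> space m" for y s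
    using bohr_avg_integrand(2)[OF f \<xi> that] by (simp add: F_def)
  have F2: "norm (F y s * cnj (F y t)) \<le> M * M" if "y \<in> space m" for y s t
    using F_le[OF that] bdd_by_nonneg[OF f] by (auto simp: norm_mult intro!: mult_mono)
  have sq: "complex_of_real ((norm (bohr_avg \<xi> k f y))\<^sup>2) = (\<integral>q. F y (fst q) * cnj (F y (snd q)) \<partial>(\<nu> k \<Otimes>\<^sub>M \<nu> k))"
    if y [measurable]: "y \<in> space m" for y
  proof -
    have [measurable]: "F y \<in> borel_measurable borel" unfolding F_def by measurable
    have "complex_of_real ((norm (bohr_avg \<xi> k f y))\<^sup>2) = bohr_avg \<xi> k f y * cnj (bohr_avg \<xi> k f y)"
      by (rule complex_norm_square)
    also have "\<dots> = (\<integral>s. (\<integral>t. F y s * cnj (F y t) \<partial>\<nu> k) \<partial>\<nu> k)"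
      by (simp add: bohr_avg_def F_def[symmetric])
    also have "\<dots> = (\<integral>q. F y (fst q) * cnj (F y (snd q)) \<partial>(\<nu> k \<Otimes>\<^sub>M \<nu> k))"
      using kk.integral_fst'[of "\<lambda>q. F y (fst q) * cnj (F y (snd q))"] F2[OF y]
      by (simp add: kk.integrable_bounded[where B="M * M"])
    finally show ?thesis .
  qed
  have "complex_of_real (\<integral>p. (norm (bohr_avg \<xi> k f (\<phi> p)))\<^sup>2 \<partial>P) = (\<integral>p. complex_of_real ((norm (bohr_avg \<xi> k f (\<phi> p)))\<^sup>2) \<partial>P)"
    by (simp only: integral_complex_of_real)
  also have "\<dots> = (\<integral>p. (\<integral>q. F (\<phi> p) (fst q) * cnj (F (\<phi> p) (snd q)) \<partial>(\<nu> k \<Otimes>\<^sub>M \<nu> k)) \<partial>P)"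
    using measurable_space[OF \<phi>] by (intro Bochner_Integration.integral_cong refl sq) auto
  also have "\<dots> = (\<integral>q. (\<integral>p. F (\<phi> p) (fst q) * cnj (F (\<phi> p) (snd q)) \<partial>P) \<partial>(\<nu> k \<Otimes>\<^sub>M \<nu> k))"
  proof (rule Fubini_bounded)
    show "prob_space (\<nu> k \<Otimes>\<^sub>M \<nu> k)" "prob_space P" by unfold_locales
    show "(\<lambda>(q, p). F (\<phi> p) (fst q) * cnj (F (\<phi> p) (snd q))) \<in> borel_measurable ((\<nu> k \<Otimes>\<^sub>M \<nu> k) \<Otimes>\<^sub>M P)"
      unfolding F_def by measurable
    show "norm (F (\<phi> p) (fst q) * cnj (F (\<phi> p) (snd q))) \<le> M * M" if "p \<in> space P" for p q
      using measurable_space[OF \<phi> that] by (rule F2)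
  qed
  also have "\<dots> = (\<integral>q. cnj (\<xi> (fst q)) * \<xi> (snd q) * (\<integral>p. f (act (fst q) (\<phi> p)) * cnj (f (act (snd q) (\<phi> p))) \<partial>P) \<partial>(\<nu> k \<Otimes>\<^sub>M \<nu> k))"
  proof (intro Bochner_Integration.integral_cong refl)
    fix q
    have "(\<integral>p. F (\<phi> p) (fst q) * cnj (F (\<phi> p) (snd q)) \<partial>P)
      = (\<integral>p. (cnj (\<xi> (fst q)) * \<xi> (snd q)) * (f (act (fst q) (\<phi> p)) * cnj (f (act (snd q) (\<phi> p)))) \<partial>P)"
      by (intro Bochner_Integration.integral_cong refl) (simp add: F_def mult_ac)
    then show "(\<integral>p. F (\<phi> p) (fst q) * cnj (F (\<phi> p) (snd q)) \<partial>P)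
      = cnj (\<xi> (fst q)) * \<xi> (snd q) * (\<integral>p. f (act (fst q) (\<phi> p)) * cnj (f (act (snd q) (\<phi> p))) \<partial>P)"
      by (simp only: integral_mult_right_zero)
  qed
  finally show ?thesis .
qed

text \<open>
  The points at which the argument works for every character. The condition does not mention characters,
  and this is what makes the exceptional null set independent of them.
\<close>

definition correlation_generic :: "('x \<Rightarrow> complex) \<Rightarrow> 'x \<Rightarrow> bool" where
  "correlation_generic f x \<longleftrightarrow> (\<forall>k. AE q in \<nu> k \<Otimes>\<^sub>M \<nu> k.
    (\<lambda>n. \<integral>u. f (act (fst q) (act u x)) * cnj (f (act (snd q) (act u x))) \<partial>\<nu> n)
      \<longlonglongrightarrow> (\<integral>y. f (act (fst q) y) * cnj (f (act (snd q) y)) \<partial>m))"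

text \<open>
  For each pair \<open>q\<close> this is the ergodic theorem; Fubini exchanges the order of the two almost everywhere
  quantifiers.
\<close>

lemma AE_correlation_generic:
  assumes erg: "ergodic act m" and f: "bdd_by M f"
  shows "AE x in m. correlation_generic f x"
  unfolding correlation_generic_def AE_all_countable
proof
  fix k
  interpret kk: pair_prob_space "\<nu> k" "\<nu> k" ..
  interpret mkk: pair_sigma_finite m "\<nu> k \<Otimes>\<^sub>M \<nu> k" ..
  have [measurable]: "f \<in> borel_measurable m" using f by (simp add: bdd_by_def)
  have bc: "bdd_by (M * M) (\<lambda>y. f (act s y) * cnj (f (act t y)))" for s t
    using bdd_byD(2)[OF f] bdd_by_nonneg[OF f]
    by (auto simp: bdd_by_def norm_mult intro!: mult_mono)
  have 1: "AE x in m. (\<lambda>n. \<integral>u. f (act (fst q) (act u x)) * cnj (f (act (snd q) (act u x))) \<partial>\<nu> n)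
      \<longlonglongrightarrow> (\<integral>y. f (act (fst q) y) * cnj (f (act (snd q) y)) \<partial>m)" for q
    by (rule ergodic_average[OF erg bc])
  have 2: "{p \<in> space (m \<Otimes>\<^sub>M (\<nu> k \<Otimes>\<^sub>M \<nu> k)).
     (\<lambda>n. \<integral>u. f (act (fst (snd p)) (act u (fst p))) * cnj (f (act (snd (snd p)) (act u (fst p)))) \<partial>\<nu> n)
      \<longlonglongrightarrow> (\<integral>y. f (act (fst (snd p)) y) * cnj (f (act (snd (snd p)) y)) \<partial>m)} \<in> sets (m \<Otimes>\<^sub>M (\<nu> k \<Otimes>\<^sub>M \<nu> k))"
    by (rule sets_Collect_tendsto) measurable
  show "AE x in m. AE q in \<nu> k \<Otimes>\<^sub>M \<nu> k.
    (\<lambda>n. \<integral>u. f (act (fst q) (act u x)) * cnj (f (act (snd q) (act u x))) \<partial>\<nu> n)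
      \<longlonglongrightarrow> (\<integral>y. f (act (fst q) y) * cnj (f (act (snd q) y)) \<partial>m)"
    using mkk.AE_commute[OF 2] 1 by simp
qed

text \<open>
  A form of the van der Corput inequality: the limit superior of \<open>|A\<^sub>n f (x)|\<^sup>2\<close> is at most \<open>I k\<close>, the
  squared norm of \<open>A\<^sub>k f\<close>, for every \<open>k\<close>, and \<open>I k\<close> tends to 0 since \<open>\<xi>\<close> has no eigenfunction.
\<close>

lemma correlation_generic_average_tendsto_0:
  assumes f: "bdd_by M f" and gen: "correlation_generic f x" and x [measurable]: "x \<in> space m"
    and \<xi>': "\<xi> \<in> dual_group - eigenvalues act m"
  shows "(\<lambda>n. bohr_avg \<xi> n f x) \<longlonglongrightarrow> 0"
proof -
  have \<xi>: "\<xi> \<in> dual_group" using \<xi>' by blast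
  have M0: "M \<ge> 0" by (rule bdd_by_nonneg[OF f])
  note bt = bdd_by_bohr_avg[OF f \<xi>]
  have [measurable]: "f \<in> borel_measurable m" "\<xi> \<in> borel_measurable borel"
    using f \<xi> by (simp_all add: bdd_by_def dual_groupD)
  define I where "I k = (\<integral>y. (norm (bohr_avg \<xi> k f y))\<^sup>2 \<partial>m)" for k
  have orbit: "(\<lambda>n. \<integral>u. (norm (bohr_avg \<xi> k f (act u x)))\<^sup>2 \<partial>\<nu> n) \<longlonglongrightarrow> I k" for k
  proof -
    interpret kk: pair_prob_space "\<nu> k" "\<nu> k" ..
    have ff: "norm (f y * cnj (f z)) \<le> M * M" if "y \<in> space m" "z \<in> space m" for y z
      using bdd_byD(2)[OF f] that M0 by (auto simp: norm_mult intro!: mult_mono)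
    have "(\<lambda>n. complex_of_real (\<integral>u. (norm (bohr_avg \<xi> k f (act u x)))\<^sup>2 \<partial>\<nu> n)) \<longlonglongrightarrow> complex_of_real (I k)"
      unfolding I_def
        bohr_avg_square_as_correlations[OF prob_space_axioms measurable_ident f \<xi>, unfolded id_apply]
        bohr_avg_square_as_correlations[OF prob_space_\<nu> measurable_act[OF measurable_ident_sets[OF sets_\<nu>] measurable_const[OF x]] f \<xi>, unfolded id_apply]
    proof (rule integral_dominated_convergence[where w="\<lambda>_. M * M"])
      show "AE q in \<nu> k \<Otimes>\<^sub>M \<nu> k. (\<lambda>n. cnj (\<xi> (fst q)) * \<xi> (snd q) *
           (\<integral>u. f (act (fst q) (act u x)) * cnj (f (act (snd q) (act u x))) \<partial>\<nu> n))
         \<longlonglongrightarrow> cnj (\<xi> (fst q)) * \<xi> (snd q) * (\<integral>y. f (act (fst q) y) * cnj (f (act (snd q) y)) \<partial>m)"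
        using gen[unfolded correlation_generic_def, rule_format, of k] by eventually_elim (intro tendsto_mult tendsto_const)
      have "norm (\<integral>u. f (act s (act u x)) * cnj (f (act t (act u x))) \<partial>\<nu> n) \<le> M * M" for s t n
        using ff x by (intro \<nu>.norm_integral_le_bound) auto
      then show "AE q in \<nu> k \<Otimes>\<^sub>M \<nu> k. norm (cnj (\<xi> (fst q)) * \<xi> (snd q) *
           (\<integral>u. f (act (fst q) (act u x)) * cnj (f (act (snd q) (act u x))) \<partial>\<nu> n)) \<le> M * M" for n
        by (simp add: norm_mult dual_groupD(2)[OF \<xi>])
    qed simp_all
    then show ?thesis by (simp only: tendsto_of_real_iff)
  qed
  \<comment> \<open>A limit that is not null would be an eigenfunction.\<close>
  have I0: "I \<longlonglongrightarrow> 0"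
  proof -
    obtain g where g: "bdd_by M g" "(\<lambda>n. \<integral>x. norm (bohr_avg \<xi> n f x - g x) \<partial>m) \<longlonglongrightarrow> 0"
      "\<And>t. AE x in m. g (act t x) = \<xi> t * g x"
      using mean_ergodic[OF f \<xi>] by blast
    have "g \<in> L2_funs m"
      using g(1) bdd_by_integrable_square by (auto simp: L2_funs_def bdd_by_def)
    then have g0: "AE x in m. g x = 0"
      using \<xi>' g(3) by (auto simp: eigenvalues_def eigenfunction_def)
    have [measurable]: "g \<in> borel_measurable m" "bohr_avg \<xi> k f \<in> borel_measurable m" for k
      using g(1) bt by (simp_all add: bdd_by_def)
    have le: "I k \<le> M * (\<integral>x. norm (bohr_avg \<xi> k f x - g x) \<partial>m)" for k
    proof -
      have "I k \<le> (\<integral>x. M * norm (bohr_avg \<xi> k f x) \<partial>m)"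
        unfolding I_def power2_eq_square
        using bdd_by_integrable_square[OF bt] bdd_by_integrable[OF bt] bdd_byD(2)[OF bt]
        by (intro integral_mono mult_right_mono) (auto simp: power2_eq_square)
      also have "\<dots> = M * (\<integral>x. norm (bohr_avg \<xi> k f x - g x) \<partial>m)"
        using g0 by (simp, intro disjI2 integral_cong_AE) auto
      finally show ?thesis .
    qed
    have "(\<lambda>k. M * (\<integral>x. norm (bohr_avg \<xi> k f x - g x) \<partial>m)) \<longlonglongrightarrow> M * 0"
      by (intro tendsto_mult tendsto_const g(2))
    then have upper: "(\<lambda>k. M * (\<integral>x. norm (bohr_avg \<xi> k f x - g x) \<partial>m)) \<longlonglongrightarrow> 0" by simp
    show ?thesis
    proof (rule tendsto_sandwich[OF _ _ tendsto_const upper])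
      show "\<forall>\<^sub>F k in sequentially. 0 \<le> I k" by (simp add: I_def)
      show "\<forall>\<^sub>F k in sequentially. I k \<le> M * (\<integral>x. norm (bohr_avg \<xi> k f x - g x) \<partial>m)"
        by (intro always_eventually allI le)
    qed
  qed
  show "(\<lambda>n. bohr_avg \<xi> n f x) \<longlonglongrightarrow> 0"
  proof (rule LIMSEQ_I)
    fix e :: real assume e: "e > 0"
    have "\<forall>\<^sub>F k in sequentially. I k < (e / 2)\<^sup>2"
      using order_tendstoD(2)[OF I0, of "(e / 2)\<^sup>2"] e by simp
    then obtain k where k: "I k < (e / 2)\<^sup>2" by (auto simp: eventually_sequentially)
    have "\<forall>\<^sub>F n in sequentially. (\<integral>u. (norm (bohr_avg \<xi> k f (act u x)))\<^sup>2 \<partial>\<nu> n) < (e / 2)\<^sup>2"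
      using order_tendstoD(2)[OF orbit k] .
    moreover have "(\<lambda>n. M * mean_defect n k) \<longlonglongrightarrow> M * 0"
      by (intro tendsto_mult tendsto_const mean_defect_tendsto)
    then have "\<forall>\<^sub>F n in sequentially. M * mean_defect n k < e / 2"
      using order_tendstoD(2)[of "\<lambda>n. M * mean_defect n k" 0 sequentially "e / 2"] e by simp
    ultimately have "\<forall>\<^sub>F n in sequentially. norm (bohr_avg \<xi> n f x) < e"
    proof eventually_elim
      case (elim n)
      have "(norm (bohr_avg \<xi> n (bohr_avg \<xi> k f) x))\<^sup>2 < (e / 2)\<^sup>2"
        using bohr_avg_square_le[OF bt \<xi> x, of n k] elim(1) by linarith
      then have "norm (bohr_avg \<xi> n (bohr_avg \<xi> k f) x) < e / 2"
        using e by (intro power_less_imp_less_base[of _ 2 "e / 2"]) auto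
      then show ?case
        using bohr_avg_bohr_avg[OF f \<xi> x, of n k] elim(2) norm_triangle_sub[of "bohr_avg \<xi> n f x" "bohr_avg \<xi> n (bohr_avg \<xi> k f) x"]
        by (simp add: norm_minus_commute)
    qed
    then show "\<exists>no. \<forall>n\<ge>no. norm (bohr_avg \<xi> n f x - 0) < e"
      by (simp add: eventually_sequentially)
  qed
qed

theorem wiener_wintner_bounded:
  assumes erg: "ergodic act m" and f: "bdd_by M f"
  shows "AE x in m. \<forall>\<xi>\<in>dual_group - eigenvalues act m. (\<lambda>n. bohr_avg \<xi> n f x) \<longlonglongrightarrow> 0"
proof (rule AE_mp[OF AE_correlation_generic[OF erg f]], rule AE_I2, intro impI ballI)
  fix x \<xi>
  assume "x \<in> space m" "correlation_generic f x" "\<xi> \<in> dual_group - eigenvalues act m"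
  then show "(\<lambda>n. bohr_avg \<xi> n f x) \<longlonglongrightarrow> 0"
    by (intro correlation_generic_average_tendsto_0[OF f])
qed

end

section \<open>From bounded functions to the core\<close>

context tempered_system begin

definition trunc :: "nat \<Rightarrow> ('x \<Rightarrow> complex) \<Rightarrow> 'x \<Rightarrow> complex" where
  "trunc j f x = (if norm (f x) \<le> real j then f x else 0)"

lemma bdd_by_trunc: "f \<in> borel_measurable m \<Longrightarrow> bdd_by (real j) (trunc j f)"
  unfolding bdd_by_def trunc_def by simp

text \<open>
  The truncation errors tend to 0 in \<open>L\<^sup>1\<close>, so the measure of their maximal sets tends to 0.
\<close>

lemma truncation_error_orbitwise_small:
  assumes f: "integrable m f"
  shows "AE x in m. \<forall>i. \<exists>j. x \<notin> maximal_set (\<lambda>x. f x - trunc j f x) (1 / Suc i)"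
  unfolding AE_all_countable
proof
  fix i
  have [measurable]: "f \<in> borel_measurable m" using f by simp
  have [measurable]: "trunc j f \<in> borel_measurable m" for j
    using bdd_by_trunc[of f j] by (simp add: bdd_by_def)
  have int: "integrable m (\<lambda>x. f x - trunc j f x)" for j
    using f bdd_by_integrable[OF bdd_by_trunc] by simp
  have "(\<lambda>j. \<integral>x. norm (f x - trunc j f x) \<partial>m) \<longlonglongrightarrow> (\<integral>x. 0 \<partial>m)"
  proof (rule integral_dominated_convergence[where w="\<lambda>x. norm (f x)"])
    show "AE x in m. (\<lambda>j. norm (f x - trunc j f x)) \<longlonglongrightarrow> 0"
    proof (rule AE_I2)
      fix x
      have "\<forall>\<^sub>F j in sequentially. norm (f x - trunc j f x) = 0"
        using eventually_ge_at_top[of "nat \<lceil>norm (f x)\<rceil>"]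
        by eventually_elim (auto simp: trunc_def)
      then show "(\<lambda>j. norm (f x - trunc j f x)) \<longlonglongrightarrow> 0"
        by (rule tendsto_eventually)
    qed
    show "AE x in m. norm (norm (f x - trunc j f x)) \<le> norm (f x)" for j
      by (auto simp: trunc_def)
  qed (use f in auto)
  then have lim: "(\<lambda>j. 2 * (1 + C) * C * (\<integral>x. norm (f x - trunc j f x) \<partial>m) / (1 / Suc i)) \<longlonglongrightarrow> 2 * (1 + C) * C * 0 / (1 / Suc i)"
    by (intro tendsto_intros) auto
  show "AE x in m. \<exists>j. x \<notin> maximal_set (\<lambda>x. f x - trunc j f x) (1 / Suc i)"
  proof (rule AE_I_small)
    fix e :: real assume e: "e > 0"
    have "\<forall>\<^sub>F j in sequentially. 2 * (1 + C) * C * (\<integral>x. norm (f x - trunc j f x) \<partial>m) / (1 / Suc i) < e"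
      using order_tendstoD(2)[OF lim, of e] e by simp
    then obtain j where j: "2 * (1 + C) * C * (\<integral>x. norm (f x - trunc j f x) \<partial>m) / (1 / Suc i) < e"
      unfolding eventually_sequentially by blast
    have "emeasure m (maximal_set (\<lambda>x. f x - trunc j f x) (1 / Suc i)) \<le> ennreal e"
      using emeasure_maximal_set[OF int, of "1 / Suc i" j] ennreal_leI[OF less_imp_le[OF j]] by simp
    then show "\<exists>Z\<in>sets m. emeasure m Z \<le> ennreal e \<and>
        (AE x in m. x \<notin> Z \<longrightarrow> (\<exists>j. x \<notin> maximal_set (\<lambda>x. f x - trunc j f x) (1 / Suc i)))"
      by (intro bexI[of _ "maximal_set (\<lambda>x. f x - trunc j f x) (1 / Suc i)"]) auto
  qed
qed

text \<open>
  What the theorem asserts about one function and one point, in terms of the probability measures \<open>\<nu> n\<close>.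
\<close>

definition bohr_regular :: "('x \<Rightarrow> complex) \<Rightarrow> 'x \<Rightarrow> bool" where
  "bohr_regular f x \<longleftrightarrow> (\<forall>n. integrable (\<nu> n) (\<lambda>t. f (act t x))) \<and>
     (\<forall>\<xi>\<in>dual_group. convergent (\<lambda>n. bohr_avg \<xi> n f x)) \<and>
     (\<forall>\<xi>\<in>dual_group - eigenvalues act m. (\<lambda>n. bohr_avg \<xi> n f x) \<longlonglongrightarrow> 0)"

lemma integrable_twisted:
  assumes [measurable]: "f \<in> borel_measurable m" "x \<in> space m" and i: "integrable (\<nu> n) (\<lambda>t. f (act t x))"
    and \<xi>: "\<xi> \<in> dual_group"
  shows "integrable (\<nu> n) (\<lambda>t. cnj (\<xi> t) * f (act t x))"
proof (rule Bochner_Integration.integrable_bound[OF i])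
  have [measurable]: "\<xi> \<in> borel_measurable borel" using \<xi> by (rule dual_groupD)
  show "(\<lambda>t. cnj (\<xi> t) * f (act t x)) \<in> borel_measurable (\<nu> n)" by measurable
qed (simp add: norm_mult dual_groupD(2)[OF \<xi>])

lemma norm_bohr_avg_diff_le:
  assumes f: "f \<in> borel_measurable m" "integrable (\<nu> n) (\<lambda>t. f (act t x))"
    and g: "g \<in> borel_measurable m" "integrable (\<nu> n) (\<lambda>t. g (act t x))"
    and x: "x \<in> space m" and \<xi>: "\<xi> \<in> dual_group"
  shows "norm (bohr_avg \<xi> n f x - bohr_avg \<xi> n g x) \<le> (\<integral>t. norm (f (act t x) - g (act t x)) \<partial>\<nu> n)"
proof -
  have "bohr_avg \<xi> n f x - bohr_avg \<xi> n g x = (\<integral>t. cnj (\<xi> t) * (f (act t x) - g (act t x)) \<partial>\<nu> n)"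
    using integrable_twisted[OF f(1) x f(2) \<xi>] integrable_twisted[OF g(1) x g(2) \<xi>]
    by (simp add: bohr_avg_def right_diff_distrib)
  also have "norm \<dots> \<le> (\<integral>t. norm (cnj (\<xi> t) * (f (act t x) - g (act t x))) \<partial>\<nu> n)"
    by simp
  finally show ?thesis by (simp add: norm_mult dual_groupD(2)[OF \<xi>])
qed

text \<open>
  Truncations are bounded, so non-eigenvalues are covered by one null set per truncation and the countably
  many eigenvalues by one null set each. Where the truncation errors have uniformly small averages,
  the averages of \<open>f\<close> are uniform limits, over \<open>n\<close>, of those of its truncations.
\<close>

theorem AE_bohr_regular:
  assumes erg: "ergodic act m" and S: "countable (eigenvalues act m)" and f: "integrable m f"
  shows "AE x in m. bohr_regular f x"
proof -
  have fm [measurable]: "f \<in> borel_measurable m" using f by simp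
  note bt = bdd_by_trunc[OF fm]
  have tm [measurable]: "trunc j f \<in> borel_measurable m" for j
    using bt[of j] by (simp add: bdd_by_def)
  have 1: "AE x in m. \<forall>j. \<forall>\<xi>\<in>dual_group - eigenvalues act m. (\<lambda>n. bohr_avg \<xi> n (trunc j f) x) \<longlonglongrightarrow> 0"
    unfolding AE_all_countable by (intro allI wiener_wintner_bounded[OF erg bt])
  have "AE x in m. convergent (\<lambda>n. bohr_avg \<xi> n (trunc j f) x)" if "\<xi> \<in> eigenvalues act m" for \<xi> j
  proof -
    have \<xi>: "\<xi> \<in> dual_group" using that by (simp add: eigenvalues_def)
    obtain g where "AE x in m. (\<lambda>n. bohr_avg \<xi> n (trunc j f) x) \<longlonglongrightarrow> g x"
      using pointwise_ergodic[OF bt \<xi>] by blast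
    then show ?thesis by eventually_elim (auto simp: convergent_def)
  qed
  then have 2: "AE x in m. \<forall>j. \<forall>\<xi>\<in>eigenvalues act m. convergent (\<lambda>n. bohr_avg \<xi> n (trunc j f) x)"
    unfolding AE_all_countable AE_ball_countable[OF S] by blast
  show ?thesis
    using 1 2 truncation_error_orbitwise_small[OF f] AE_space
  proof eventually_elim
    case (elim x)
    have x: "x \<in> space m" by (rule elim(4))
    have tint: "integrable (\<nu> n) (\<lambda>t. trunc j f (act t x))" for n j
      using bohr_avg_integrand(3)[OF bt one_in_dual x] by simp
    have ex: "\<exists>j. \<forall>n. integrable (\<nu> n) (\<lambda>t. f (act t x)) \<and>
         (\<integral>t. norm (f (act t x) - trunc j f (act t x)) \<partial>\<nu> n) \<le> e" if e: "e > 0" for e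
    proof -
      obtain i where i: "1 / Suc i < e" using nat_approx_posE[OF e] by blast
      obtain j where j: "x \<notin> maximal_set (\<lambda>x. f x - trunc j f x) (1 / Suc i)" using elim(3) by blast
      have "integrable (\<nu> n) (\<lambda>t. f (act t x) - trunc j f (act t x))"
        "(\<integral>t. norm (f (act t x) - trunc j f (act t x)) \<partial>\<nu> n) \<le> 1 / Suc i" for n
        using not_maximal_setD[OF _ x j, of n] by simp_all
      note u = this
      have "integrable (\<nu> n) (\<lambda>t. f (act t x))" for n
        using Bochner_Integration.integrable_add[OF u(1) tint, of n j] by simp
      moreover have "(\<integral>t. norm (f (act t x) - trunc j f (act t x)) \<partial>\<nu> n) \<le> e" for n
        using u(2)[of n] i by linarith
      ultimately show ?thesis by blast
    qed
    have fint: "integrable (\<nu> n) (\<lambda>t. f (act t x))" for n using ex[of 1] by auto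
    have approx: "\<exists>Y. (\<forall>n. norm (bohr_avg \<xi> n f x - Y n) \<le> e) \<and> (\<exists>j. Y = (\<lambda>n. bohr_avg \<xi> n (trunc j f) x))"
      if \<xi>: "\<xi> \<in> dual_group" and e: "e > 0" for \<xi> e
    proof -
      obtain j where j: "\<And>n. (\<integral>t. norm (f (act t x) - trunc j f (act t x)) \<partial>\<nu> n) \<le> e"
        using ex[OF e] by blast
      show ?thesis
        using order_trans[OF norm_bohr_avg_diff_le[OF fm fint tm tint x \<xi>] j]
        by (intro exI[of _ "\<lambda>n. bohr_avg \<xi> n (trunc j f) x"] conjI allI exI[of _ j] refl)
    qed
    have "convergent (\<lambda>n. bohr_avg \<xi> n f x)" if \<xi>: "\<xi> \<in> dual_group" for \<xi>
    proof (rule uniformly_approximated_limits(1)[OF approx[OF \<xi>]])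
      show "convergent Y" if "\<exists>j. Y = (\<lambda>n. bohr_avg \<xi> n (trunc j f) x)" for Y
      proof (cases "\<xi> \<in> eigenvalues act m")
        case True
        then show ?thesis using elim(2) that by blast
      next
        case False
        then show ?thesis using elim(1) that \<xi> by (auto simp: convergent_def)
      qed
    qed
    moreover have "(\<lambda>n. bohr_avg \<xi> n f x) \<longlonglongrightarrow> 0" if \<xi>: "\<xi> \<in> dual_group - eigenvalues act m" for \<xi>
    proof (rule uniformly_approximated_limits(2)[OF approx])
      show "Y \<longlonglongrightarrow> 0" if "\<exists>j. Y = (\<lambda>n. bohr_avg \<xi> n (trunc j f) x)" for Y
        using elim(1) that \<xi> by blast
    qed (use \<xi> in auto)
    ultimately show ?case using fint by (auto simp: bohr_regular_def)
  qed
qed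

lemma bohr_regular_subspace:
  assumes x: "x \<in> space m"
  shows "cfun.subspace {f \<in> borel_measurable m. bohr_regular f x}"
proof -
  have zero: "bohr_regular (\<lambda>_. 0) x"
    by (auto simp: bohr_regular_def bohr_avg_def convergent_const)
  have add: "bohr_regular (\<lambda>y. f y + g y) x"
    if f: "f \<in> borel_measurable m" "bohr_regular f x" and g: "g \<in> borel_measurable m" "bohr_regular g x" for f g
  proof -
    have i: "integrable (\<nu> n) (\<lambda>t. f (act t x))" "integrable (\<nu> n) (\<lambda>t. g (act t x))" for n
      using f g by (auto simp: bohr_regular_def)
    have bohr_avg: "(\<lambda>n. bohr_avg \<xi> n (\<lambda>y. f y + g y) x) = (\<lambda>n. bohr_avg \<xi> n f x + bohr_avg \<xi> n g x)" if \<xi>: "\<xi> \<in> dual_group" for \<xi>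
      using integrable_twisted[OF f(1) x i(1) \<xi>] integrable_twisted[OF g(1) x i(2) \<xi>]
      by (simp add: bohr_avg_def distrib_left)
    show ?thesis
      using f(2) g(2) i unfolding bohr_regular_def
      by (auto simp: bohr_avg intro: convergent_add intro!: tendsto_add_zero)
  qed
  have scale: "bohr_regular (\<lambda>y. c * f y) x" if f: "f \<in> borel_measurable m" "bohr_regular f x" for f c
  proof -
    have bohr_avg: "bohr_avg \<xi> n (\<lambda>y. c * f y) x = c * bohr_avg \<xi> n f x" for \<xi> n
      unfolding bohr_avg_def by (subst integral_mult_right_zero[symmetric]) (simp add: mult_ac)
    show ?thesis
      using f(2) unfolding bohr_regular_def
      by (auto simp: bohr_avg intro: convergent_mult convergent_const intro!: tendsto_mult_right_zero)
  qed
  show ?thesis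
    unfolding cfun.subspace_def
    using zero add scale by (auto simp: zero_fun_def plus_fun_def)
qed

text \<open>
  Averages are nonexpansive for the supremum norm, so they converge uniformly in \<open>n\<close>. Integrability of \<open>f\<close>
  along the orbit follows as well, since \<open>f\<close> differs from some \<open>s k\<close> by a bounded function.
\<close>

lemma bohr_regular_uniform_limit:
  assumes x: "x \<in> space m" and f: "f \<in> borel_measurable m"
    and s: "\<And>k. s k \<in> borel_measurable m" "\<And>k. bohr_regular (s k) x"
    and lim: "uniform_limit (space m) s f sequentially"
  shows "bohr_regular f x"
proof -
  have [measurable]: "x \<in> space m" "f \<in> borel_measurable m" "\<And>k. s k \<in> borel_measurable m" by fact+
  have sint: "integrable (\<nu> n) (\<lambda>t. s k (act t x))" for n k using s by (auto simp: bohr_regular_def)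
  have ex: "\<exists>k. \<forall>y\<in>space m. norm (f y - s k y) \<le> e" if e: "e > 0" for e
    using uniform_limitD[OF lim e] by (auto simp: eventually_sequentially dist_norm norm_minus_commute intro: less_imp_le)
  have fint: "integrable (\<nu> n) (\<lambda>t. f (act t x))" for n
  proof -
    obtain k where k: "\<forall>y\<in>space m. norm (f y - s k y) \<le> 1" using ex[of 1] by auto
    have "integrable (\<nu> n) (\<lambda>t. f (act t x) - s k (act t x))"
      using k x by (intro \<nu>.integrable_bounded[where B=1]) auto
    from Bochner_Integration.integrable_add[OF this sint[of n k]] show ?thesis by simp
  qed
  have approx: "\<exists>Y. (\<forall>n. norm (bohr_avg \<xi> n f x - Y n) \<le> e) \<and> (\<exists>k. Y = (\<lambda>n. bohr_avg \<xi> n (s k) x))"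
    if \<xi>: "\<xi> \<in> dual_group" and e: "e > 0" for \<xi> e
  proof -
    obtain k where k: "\<forall>y\<in>space m. norm (f y - s k y) \<le> e" using ex[OF e] by blast
    have "norm (bohr_avg \<xi> n f x - bohr_avg \<xi> n (s k) x) \<le> e" for n
    proof -
      have "norm (bohr_avg \<xi> n f x - bohr_avg \<xi> n (s k) x) \<le> (\<integral>t. norm (f (act t x) - s k (act t x)) \<partial>\<nu> n)"
        by (rule norm_bohr_avg_diff_le[OF f fint s(1) sint x \<xi>])
      also have "\<dots> \<le> (\<integral>t. e \<partial>\<nu> n)"
        using k x fint sint by (intro integral_mono integrable_norm Bochner_Integration.integrable_diff) auto
      finally show ?thesis by (simp add: \<nu>.prob_space[simplified])
    qed
    then show ?thesis
      by (intro exI[of _ "\<lambda>n. bohr_avg \<xi> n (s k) x"] conjI allI exI[of _ k] refl)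
  qed
  have "convergent (\<lambda>n. bohr_avg \<xi> n f x)" if \<xi>: "\<xi> \<in> dual_group" for \<xi>
    by (rule uniformly_approximated_limits(1)[OF approx[OF \<xi>]]) (use s(2) \<xi> in \<open>auto simp: bohr_regular_def\<close>)
  moreover have "(\<lambda>n. bohr_avg \<xi> n f x) \<longlonglongrightarrow> 0" if \<xi>: "\<xi> \<in> dual_group - eigenvalues act m" for \<xi>
    by (rule uniformly_approximated_limits(2)[OF approx]) (use s(2) \<xi> in \<open>auto simp: bohr_regular_def\<close>)
  ultimately show ?thesis using fint by (auto simp: bohr_regular_def)
qed

lemma has_fourier_bohr_coeff_iff:
  assumes f [measurable]: "f \<in> borel_measurable m" and x [measurable]: "x \<in> space m"
    and reg: "bohr_regular f x" and \<xi>: "\<xi> \<in> dual_group"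
  shows "has_fourier_bohr_coeff \<mu> A (\<lambda>t. f (act t x)) \<xi> a \<longleftrightarrow> (\<lambda>n. bohr_avg \<xi> n f x) \<longlonglongrightarrow> a"
proof -
  have [measurable]: "\<xi> \<in> borel_measurable borel" using \<xi> by (rule dual_groupD)
  have i: "integrable (\<nu> n) (\<lambda>t. f (act t x) * cnj (\<xi> t))" for n
    using integrable_twisted[OF f x _ \<xi>, of n] reg by (simp add: bohr_regular_def mult.commute)
  have "set_integrable \<mu> (A n) (\<lambda>t. f (act t x) * cnj (\<xi> t))" for n
    using i[of n] unfolding set_integrable_def by (subst (asm) integral_\<nu>(2)) auto
  moreover have "(LINT t:A n|\<mu>. f (act t x) * cnj (\<xi> t)) / complex_of_real (measure \<mu> (A n)) = bohr_avg \<xi> n f x" for n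
    unfolding bohr_avg_def set_lebesgue_integral_def
    by (subst integral_\<nu>(1)) (simp_all add: mult.commute scaleR_conv_of_real divide_inverse)
  ultimately show ?thesis
    unfolding has_fourier_bohr_coeff_def by simp
qed

text \<open>
  Invariance of the measure multiplies the inner product by \<open>\<xi> t cnj (\<eta> t)\<close>, which is not 1 for a suitable \<open>t\<close>.
\<close>

lemma eigenfunctions_orthogonal:
  assumes e: "eigenfunction act m \<xi> e" and d: "eigenfunction act m \<eta> d"
    and \<xi>: "\<xi> \<in> dual_group" and \<eta>: "\<eta> \<in> dual_group" and ne: "\<xi> \<noteq> \<eta>"
  shows "(\<integral>x. e x * cnj (d x) \<partial>m) = 0"
proof -
  have [measurable]: "e \<in> borel_measurable m" "d \<in> borel_measurable m"
    using e d by (auto simp: eigenfunction_def L2_funs_def)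
  obtain t where t: "\<xi> t \<noteq> \<eta> t" using ne by blast
  define I where "I = (\<integral>x. e x * cnj (d x) \<partial>m)"
  have "I = (\<integral>x. e (act t x) * cnj (d (act t x)) \<partial>m)"
    unfolding I_def by (rule integral_act[symmetric]) measurable
  also have "\<dots> = (\<integral>x. (\<xi> t * cnj (\<eta> t)) * (e x * cnj (d x)) \<partial>m)"
  proof (rule integral_cong_AE)
    have "AE x in m. e (act t x) = \<xi> t * e x" "AE x in m. d (act t x) = \<eta> t * d x"
      using e d by (auto simp: eigenfunction_def)
    then show "AE x in m. e (act t x) * cnj (d (act t x)) = (\<xi> t * cnj (\<eta> t)) * (e x * cnj (d x))"
      by eventually_elim simp
  qed measurable
  also have "\<dots> = (\<xi> t * cnj (\<eta> t)) * I"
    unfolding I_def by (rule integral_mult_right_zero)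
  finally have "(1 - \<xi> t * cnj (\<eta> t)) * I = 0" by (simp add: algebra_simps)
  moreover have "\<xi> t * cnj (\<eta> t) \<noteq> 1"
  proof
    assume "\<xi> t * cnj (\<eta> t) = 1"
    then have "\<xi> t * (\<eta> t * cnj (\<eta> t)) = \<eta> t" by (simp add: mult_ac)
    then show False using t dual_groupD(4)[OF \<eta>] by simp
  qed
  ultimately show ?thesis by (simp add: I_def)
qed

text \<open>
  Normalised eigenfunctions are at mutual squared distance 2, so elements of a dense set within distance
  1/2 of them are distinct.
\<close>

lemma countable_eigenvalues:
  assumes sep: "L2_separable m"
  shows "countable (eigenvalues act m)"
proof -
  define q where "q f = (\<integral>x. (norm (f x))\<^sup>2 \<partial>m)" for f :: "'x \<Rightarrow> complex"
  obtain D where D: "countable D" "D \<subseteq> L2_funs m"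
    "\<And>f \<epsilon>. f \<in> L2_funs m \<Longrightarrow> \<epsilon> > 0 \<Longrightarrow> \<exists>g\<in>D. L2_norm m (\<lambda>x. f x - g x) < \<epsilon>"
    using sep unfolding L2_separable_def by blast
  have "\<exists>e. eigenfunction act m \<xi> e \<and> q e = 1" if \<xi>S: "\<xi> \<in> eigenvalues act m" for \<xi>
  proof -
    obtain e where e: "eigenfunction act m \<xi> e" using \<xi>S unfolding eigenvalues_def by blast
    have em: "e \<in> borel_measurable m" "integrable m (\<lambda>x. (norm (e x))\<^sup>2)" "\<not> (AE x in m. e x = 0)"
      using e by (auto simp: eigenfunction_def L2_funs_def)
    have "q e \<noteq> 0"
      unfolding q_def using em by (subst integral_nonneg_eq_0_iff_AE) auto
    moreover have "q e \<ge> 0" by (simp add: q_def)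
    ultimately have q: "q e > 0" by simp
    define c where "c = complex_of_real (1 / sqrt (q e))"
    have c: "c \<noteq> 0" "(norm c)\<^sup>2 * q e = 1" using q by (auto simp: c_def norm_divide power_divide)
    have "eigenfunction act m \<xi> (\<lambda>x. c * e x)"
      using e c(1) unfolding eigenfunction_def L2_funs_def
      by (auto simp: norm_mult power_mult_distrib mult_ac)
    moreover have "q (\<lambda>x. c * e x) = 1"
      using c(2) by (simp add: q_def norm_mult power_mult_distrib)
    ultimately show ?thesis by blast
  qed
  then obtain e where e: "\<And>\<xi>. \<xi> \<in> eigenvalues act m \<Longrightarrow> eigenfunction act m \<xi> (e \<xi>)"
    "\<And>\<xi>. \<xi> \<in> eigenvalues act m \<Longrightarrow> q (e \<xi>) = 1"
    by metis
  have eL2: "e \<xi> \<in> L2_funs m" if "\<xi> \<in> eigenvalues act m" for \<xi>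
    using e(1)[OF that] by (simp add: eigenfunction_def)
  have "\<exists>g\<in>D. L2_norm m (\<lambda>x. e \<xi> x - g x) < 1 / 2" if "\<xi> \<in> eigenvalues act m" for \<xi>
    by (rule D(3)[OF eL2[OF that]]) simp
  then obtain d where d: "\<And>\<xi>. \<xi> \<in> eigenvalues act m \<Longrightarrow> d \<xi> \<in> D"
    "\<And>\<xi>. \<xi> \<in> eigenvalues act m \<Longrightarrow> L2_norm m (\<lambda>x. e \<xi> x - d \<xi> x) < 1 / 2"
    by metis
  have q_small: "q (\<lambda>x. e \<xi> x - d \<xi> x) < 1 / 4" if "\<xi> \<in> eigenvalues act m" for \<xi>
  proof -
    have "sqrt (q (\<lambda>x. e \<xi> x - d \<xi> x)) < 1 / 2" using d(2)[OF that] by (simp add: L2_norm_def q_def)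
    also have "1 / 2 = sqrt (1 / 4)" by (simp add: real_sqrt_divide)
    finally show ?thesis by (simp only: real_sqrt_less_iff)
  qed
  have par: "(norm (a - b))\<^sup>2 \<le> 2 * (norm a)\<^sup>2 + 2 * (norm b)\<^sup>2" for a b :: complex
  proof -
    have "(norm (a - b))\<^sup>2 + (norm (a + b))\<^sup>2 = 2 * (norm a)\<^sup>2 + 2 * (norm b)\<^sup>2"
      unfolding cmod_power2 by (simp add: power2_eq_square algebra_simps)
    then show ?thesis by (smt (verit) zero_le_power2)
  qed
  have L2_diff: "integrable m (\<lambda>x. (norm (f x - g x))\<^sup>2)" if "f \<in> L2_funs m" "g \<in> L2_funs m" for f g
  proof (rule Bochner_Integration.integrable_bound[where f="\<lambda>x. 2 * (norm (f x))\<^sup>2 + 2 * (norm (g x))\<^sup>2"])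
    show "integrable m (\<lambda>x. 2 * (norm (f x))\<^sup>2 + 2 * (norm (g x))\<^sup>2)"
      "(\<lambda>x. (norm (f x - g x))\<^sup>2) \<in> borel_measurable m"
      using that by (auto simp: L2_funs_def)
    show "AE x in m. norm ((norm (f x - g x))\<^sup>2) \<le> norm (2 * (norm (f x))\<^sup>2 + 2 * (norm (g x))\<^sup>2)"
      by (intro AE_I2) (simp add: par)
  qed
  have "inj_on d (eigenvalues act m)"
  proof (rule inj_onI, rule ccontr)
    fix \<xi> \<eta> assume \<xi>: "\<xi> \<in> eigenvalues act m" and \<eta>: "\<eta> \<in> eigenvalues act m"
      and deq: "d \<xi> = d \<eta>" and ne: "\<xi> \<noteq> \<eta>"
    have i: "integrable m (\<lambda>x. (norm (e \<xi> x))\<^sup>2)" "integrable m (\<lambda>x. (norm (e \<eta> x))\<^sup>2)"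
      using eL2[OF \<xi>] eL2[OF \<eta>] by (auto simp: L2_funs_def)
    have [measurable]: "e \<xi> \<in> borel_measurable m" "e \<eta> \<in> borel_measurable m"
      using eL2[OF \<xi>] eL2[OF \<eta>] by (auto simp: L2_funs_def)
    have ic: "integrable m (\<lambda>x. e \<xi> x * cnj (e \<eta> x))"
    proof (rule Bochner_Integration.integrable_bound[where f="\<lambda>x. (norm (e \<xi> x))\<^sup>2 + (norm (e \<eta> x))\<^sup>2"])
      have "norm a * norm b \<le> (norm a)\<^sup>2 + (norm b)\<^sup>2" for a b :: complex
        using sum_squares_bound[of "norm a" "norm b"] mult_nonneg_nonneg[OF norm_ge_zero[of a] norm_ge_zero[of b]]
        by linarith
      then show "AE x in m. norm (e \<xi> x * cnj (e \<eta> x)) \<le> norm ((norm (e \<xi> x))\<^sup>2 + (norm (e \<eta> x))\<^sup>2)"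
        by (simp add: norm_mult)
    qed (use i in auto)
    have orth: "(\<integral>x. e \<xi> x * cnj (e \<eta> x) \<partial>m) = 0"
      using \<xi> \<eta> ne by (intro eigenfunctions_orthogonal[OF e(1) e(1)]) (auto simp: eigenvalues_def)
    define p where "p x = e \<xi> x * cnj (e \<eta> x)" for x
    have ip: "integrable m p" and ip0: "(\<integral>x. p x \<partial>m) = 0"
      using ic orth by (simp_all add: p_def[abs_def])
    have expand: "(norm (e \<xi> x - e \<eta> x))\<^sup>2 = (norm (e \<xi> x))\<^sup>2 + (norm (e \<eta> x))\<^sup>2 - 2 * Re (p x)" for x
      unfolding p_def cmod_power2 by (simp add: power2_eq_square algebra_simps)
    have "q (\<lambda>x. e \<xi> x - e \<eta> x) = q (e \<xi>) + q (e \<eta>) - 2 * (\<integral>x. Re (p x) \<partial>m)"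
      unfolding q_def expand using i integrable_Re[OF ip] by simp
    also have "(\<integral>x. Re (p x) \<partial>m) = 0"
      using integral_Re[OF ip] ip0 by simp
    finally have two: "q (\<lambda>x. e \<xi> x - e \<eta> x) = 2" using e(2) \<xi> \<eta> by simp
    have "d \<xi> \<in> L2_funs m" using d(1)[OF \<xi>] D(2) by blast
    note j = L2_diff[OF eL2[OF \<xi>] this] L2_diff[OF eL2[OF \<eta>] this]
    have "q (\<lambda>x. e \<xi> x - e \<eta> x) \<le> (\<integral>x. 2 * (norm (e \<xi> x - d \<xi> x))\<^sup>2 + 2 * (norm (e \<eta> x - d \<xi> x))\<^sup>2 \<partial>m)"
      unfolding q_def
    proof (rule integral_mono)
      show "(norm (e \<xi> x - e \<eta> x))\<^sup>2 \<le> 2 * (norm (e \<xi> x - d \<xi> x))\<^sup>2 + 2 * (norm (e \<eta> x - d \<xi> x))\<^sup>2" for x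
        using par[of "e \<xi> x - d \<xi> x" "e \<eta> x - d \<xi> x"] by simp
    qed (use j L2_diff[OF eL2[OF \<xi>] eL2[OF \<eta>]] in auto)
    also have "\<dots> = 2 * q (\<lambda>x. e \<xi> x - d \<xi> x) + 2 * q (\<lambda>x. e \<eta> x - d \<eta> x)"
      using j by (simp add: q_def deq)
    also have "\<dots> < 2" using q_small[OF \<xi>] q_small[OF \<eta>] by simp
    finally show False using two by simp
  qed
  moreover have "countable (d ` eigenvalues act m)"
    using d(1) by (intro countable_subset[OF _ D(1)]) auto
  ultimately show ?thesis by (rule countable_image_inj_on[rotated])
qed

lemma integrable_L2_funs:
  assumes f: "f \<in> L2_funs m" shows "integrable m f"
proof (rule Bochner_Integration.integrable_bound[where f="\<lambda>x. 1 + (norm (f x))\<^sup>2"])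
  have "norm a \<le> 1 + (norm a)\<^sup>2" for a :: complex
    using sum_squares_bound[of 1 "norm a"] norm_ge_zero[of a]
    unfolding power_one mult_1_right by linarith
  then show "AE x in m. norm (f x) \<le> norm (1 + (norm (f x))\<^sup>2)" by simp
qed (use f in \<open>auto simp: L2_funs_def\<close>)

end

theorem theorem3p10:
  fixes \<mu> :: "'g::{topological_ab_group_add, t2_space, second_countable_topology} measure"
    and act :: "'g \<Rightarrow> 'x \<Rightarrow> 'x"
    and m :: "'x measure"
    and A :: "nat \<Rightarrow> 'g set"
    and E :: "('x \<Rightarrow> complex) set"
  assumes "locally_compact_space (euclidean :: 'g topology)"
    and "haar_measure \<mu>"
    and "measurable_dynamical_system act m"
    and "prob_space m"
    and "ergodic act m"
    and "L2_separable m"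
    and "folner_sequence \<mu> A"
    and "tempered \<mu> A"
    and "E \<subseteq> L2_funs m"
    and "cfun.subspace E"
    and "\<exists>F. countable F \<and> core_for (space m) F E"
  shows "\<exists>X0\<in>sets m. emeasure m X0 = 1 \<and>
           (\<forall>f\<in>E. \<forall>x\<in>X0. \<forall>\<xi>\<in>dual_group.
              \<exists>a. has_fourier_bohr_coeff \<mu> A (\<lambda>t. f (act t x)) \<xi> a) \<and>
           (\<forall>f\<in>E. \<forall>x\<in>X0. \<forall>\<xi>\<in>dual_group - eigenvalues act m.
              has_fourier_bohr_coeff \<mu> A (\<lambda>t. f (act t x)) \<xi> 0)"
proof -
  obtain C where C: "C > 0"
    "\<And>n. emeasure \<mu> (\<Union>k<n. {a - b |a b. a \<in> A n \<and> b \<in> A k}) \<le> ennreal C * emeasure \<mu> (A n)"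
    using \<open>tempered \<mu> A\<close> by (auto simp: tempered_def)
  interpret prob_space m by fact
  interpret tempered_system \<mu> A C m act
    using assms C by unfold_locales auto
  obtain F where F: "countable F" "F \<subseteq> E"
    "\<And>f. f \<in> E \<Longrightarrow> \<exists>s. (\<forall>n. s n \<in> cfun.span F) \<and> uniform_limit (space m) s f sequentially"
    using assms(11) unfolding core_for_def by blast
  have meas: "f \<in> borel_measurable m" if "f \<in> E" for f
    using that assms(9) by (auto simp: L2_funs_def)
  have "AE x in m. \<forall>f\<in>F. bohr_regular f x"
    unfolding AE_ball_countable[OF F(1)]
    using F(2) assms(9)
    by (intro ballI AE_bohr_regular[OF assms(5) countable_eigenvalues[OF assms(6)]] integrable_L2_funs) blast
  then obtain N where N: "N \<in> null_sets m" "{x \<in> space m. \<not> (\<forall>f\<in>F. bohr_regular f x)} \<subseteq> N"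
    unfolding eventually_ae_filter by blast
  define X0 where "X0 = space m - N"
  have X0: "X0 \<in> sets m" "emeasure m X0 = 1"
    using N(1) by (auto simp: X0_def emeasure_Diff_null_set emeasure_space_1)
  have reg: "bohr_regular f x" if f: "f \<in> E" and x: "x \<in> X0" for f x
  proof -
    have xs: "x \<in> space m" and xF: "\<forall>f\<in>F. bohr_regular f x"
      using x N(2) by (auto simp: X0_def)
    have span: "cfun.span F \<subseteq> {f \<in> borel_measurable m. bohr_regular f x}"
      using xF F(2) meas by (intro cfun.span_minimal bohr_regular_subspace xs) blast
    obtain s where "\<And>n. s n \<in> cfun.span F" "uniform_limit (space m) s f sequentially"
      using F(3)[OF f] by blast
    then show ?thesis
      using span by (intro bohr_regular_uniform_limit[OF xs meas[OF f], of s]) auto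
  qed
  have "\<exists>a. has_fourier_bohr_coeff \<mu> A (\<lambda>t. f (act t x)) \<xi> a"
    if "f \<in> E" "x \<in> X0" "\<xi> \<in> dual_group" for f x \<xi>
    using that reg[OF that(1,2)] has_fourier_bohr_coeff_iff[OF meas[OF that(1)] _ reg[OF that(1,2)] that(3)]
    by (auto simp: X0_def bohr_regular_def convergent_def)
  moreover have "has_fourier_bohr_coeff \<mu> A (\<lambda>t. f (act t x)) \<xi> 0"
    if "f \<in> E" "x \<in> X0" "\<xi> \<in> dual_group - eigenvalues act m" for f x \<xi>
    using that reg[OF that(1,2)] has_fourier_bohr_coeff_iff[OF meas[OF that(1)] _ reg[OF that(1,2)], of \<xi>]
    by (auto simp: X0_def bohr_regular_def)
  ultimately show ?thesis using X0 by blast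
qed

end
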